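(* Let $(\mathbb{D},F=\alpha+\beta)$ be the Randers Poincaré disc. Then for every $0<a<1$ the circle $\gamma_0(t)=(a\cos t,a\sin t)$, $t\in[0,2\pi]$, is a solution of the isoperimetric problem in $(\mathbb{D},F)$ with respect to each of the following four volume forms: the Busemann–Hausdorff, the Holmes–Thompson, the maximum and the minimum volume form of $F$. That is, for each of these volume forms $dV_\mu$, among all simple closed piecewise smooth curves in $\mathbb{D}$ whose $F$-length equals that of $\gamma_0$, the curve $\gamma_0$ maximizes the area $A_\mu(D)=\int_D dV_\mu$ of the enclosed domain $D$.
   Context: Randers Poincaré disc: $\mathbb{D}=\{(x^1,x^2)\in\mathbb{R}^2:(x^1)^2+(x^2)^2<1\}$ with the Finsler metric $F=\alpha+\beta$, where $\alpha=\frac{2\sqrt{(dx^1)^2+(dx^2)^2}}{1-(x^1)^2-(x^2)^2}$ is the Poincaré metric and $\beta=df$ is exact, with $f:\mathbb{D}\to\mathbb{R}$ a smooth function such that $\|\beta\|_\alpha$ is constant and $\|\beta\|_\alpha<1$. Here, for $\alpha=\sqrt{a_{ij}dx^idx^j}$ and $\beta=b_idx^i$, $\|\beta\|_\alpha=\sqrt{a^{ij}b_ib_j}$ with $(a^{ij})=(a_{ij})^{-1}$. The $F$-length of a piecewise smooth curve $\gamma:[t_0,t_1]\to\mathbb{D}$ is $\int_{t_0}^{t_1}F(\gamma(t),\dot\gamma(t))\,dt$. Volume forms of an $n$-dimensional Finsler manifold (here $n=2$): with $g_{ij}(x,y)=\frac12\frac{\partial^2F^2}{\partial y^i\partial y^j}(x,y)$,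 $B^n(1)$ the Euclidean unit ball, $\mathrm{vol}$ the Euclidean volume, and $I_x=\{y\in T_xM: F(x,y)=1\}$, $dV_{BH}=\sigma_{BH}(x)\,dx$ with $\sigma_{BH}(x)=\frac{\mathrm{vol}(B^n(1))}{\mathrm{vol}\{y\in T_xM:F(x,y)<1\}}$ (Busemann–Hausdorff); $dV_{HT}=\sigma_{HT}(x)\,dx$ with $\sigma_{HT}(x)=\frac{1}{\mathrm{vol}(B^n(1))}\int_{F(x,y)<1}\det(g_{ij}(x,y))\,dy$ (Holmes–Thompson); $dV_{\max}=\sigma_{\max}(x)\,dx$ with $\sigma_{\max}(x)=\max_{y\in I_x}\sqrt{\det(g_{ij}(x,y))}$ (maximum); $dV_{\min}=\sigma_{\min}(x)\,dx$ with $\sigma_{\min}(x)=\min_{y\in I_x}\sqrt{\det(g_{ij}(x,y))}$ (minimum). *)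

theory Defs
  imports "HOL-Analysis.Analysis"
begin

definition partial_deriv :: "'n \<Rightarrow> (real^'n \<Rightarrow> real) \<Rightarrow> real^'n \<Rightarrow> real" where
  "partial_deriv i h x = frechet_derivative h (at x) (axis i 1)"

text \<open>The next two definitions are meant for open \<open>U\<close>, where differentiability within \<open>U\<close>
  is differentiability and \<open>partial_deriv\<close> depends only on the values on \<open>U\<close>.\<close>

fun C_k_on :: "nat \<Rightarrow> (real^'n) set \<Rightarrow> (real^'n \<Rightarrow> real) \<Rightarrow> bool" where
  "C_k_on 0 U h \<longleftrightarrow> continuous_on U h"
| "C_k_on (Suc k) U h \<longleftrightarrow> h differentiable_on U \<and> (\<forall>i. C_k_on k U (partial_deriv i h))"

definition smooth_fun_on :: "(real^'n) set \<Rightarrow> (real^'n \<Rightarrow> real) \<Rightarrow> bool" where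
  "smooth_fun_on U h \<longleftrightarrow> (\<forall>k. C_k_on k U h)"

text \<open>\<open>d k\<close> is the \<open>k\<close>-th derivative; at the endpoints the derivatives are one-sided.\<close>

definition smooth_arc :: "real \<Rightarrow> real \<Rightarrow> (real \<Rightarrow> real^'n) \<Rightarrow> bool" where
  "smooth_arc u v \<gamma> \<longleftrightarrow>
     (\<exists>d :: nat \<Rightarrow> real \<Rightarrow> real^'n. (\<forall>t\<in>{u..v}. d 0 t = \<gamma> t) \<and>
        (\<forall>k. \<forall>t\<in>{u..v}. (d k has_vector_derivative d (Suc k) t) (at t within {u..v})))"

text \<open>Smoothness is required on the closed pieces, so \<open>\<gamma>\<close> is continuous. (The library's
  \<open>piecewise_C1_differentiable_on\<close> does not control the derivative near the break points.)\<close>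

definition piecewise_smooth_curve :: "real \<Rightarrow> real \<Rightarrow> (real \<Rightarrow> real^'n) \<Rightarrow> bool" where
  "piecewise_smooth_curve t0 t1 \<gamma> \<longleftrightarrow>
     (\<exists>(s :: nat \<Rightarrow> real) N. s 0 = t0 \<and> s N = t1 \<and>
        (\<forall>i<N. s i < s (Suc i) \<and> smooth_arc (s i) (s (Suc i)) \<gamma>))"

definition simple_closed_piecewise_smooth_in ::
    "(real^'n) set \<Rightarrow> real \<Rightarrow> real \<Rightarrow> (real \<Rightarrow> real^'n) \<Rightarrow> bool" where
  "simple_closed_piecewise_smooth_in M t0 t1 \<gamma> \<longleftrightarrow>
     t0 < t1 \<and> piecewise_smooth_curve t0 t1 \<gamma> \<and>
     simple_path (subpath t0 t1 \<gamma>) \<and> \<gamma> t1 = \<gamma> t0 \<and> \<gamma> ` {t0..t1} \<subseteq> M"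


text \<open>A Finsler metric on an open subset of \<open>real^'n\<close> is given as a function \<open>F x y\<close> of a base
  point \<open>x\<close> and a tangent vector \<open>y\<close>.\<close>

text \<open>The velocity takes a junk value at most at the finitely many break points, which the
  integral does not see.\<close>

definition finsler_length ::
    "(real^'n \<Rightarrow> real^'n \<Rightarrow> real) \<Rightarrow> real \<Rightarrow> real \<Rightarrow> (real \<Rightarrow> real^'n) \<Rightarrow> real" where
  "finsler_length F t0 t1 \<gamma> =
     integral {t0..t1} (\<lambda>t. F (\<gamma> t) (vector_derivative \<gamma> (at t within {t0..t1})))"

definition fundamental_tensor ::
    "(real^'n \<Rightarrow> real^'n \<Rightarrow> real) \<Rightarrow> real^'n \<Rightarrow> real^'n \<Rightarrow> real^'n^'n" where
  "fundamental_tensor F x y =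
     (\<chi> i j. 1/2 * partial_deriv i (partial_deriv j (\<lambda>z. (F x z)\<^sup>2)) y)"

definition indicatrix :: "(real^'n \<Rightarrow> real^'n \<Rightarrow> real) \<Rightarrow> real^'n \<Rightarrow> (real^'n) set" where
  "indicatrix F x = {y. F x y = 1}"

definition sigma_BH :: "(real^'n \<Rightarrow> real^'n \<Rightarrow> real) \<Rightarrow> real^'n \<Rightarrow> real" where
  "sigma_BH F x =
     measure lborel (ball (0::real^'n) 1) / measure lborel {y. F x y < 1}"

text \<open>The integrand is junk at \<open>y = 0\<close>, where \<open>F\<^sup>2\<close> need not be twice differentiable; this is a
  null set.\<close>

definition sigma_HT :: "(real^'n \<Rightarrow> real^'n \<Rightarrow> real) \<Rightarrow> real^'n \<Rightarrow> real" where
  "sigma_HT F x =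
     1 / measure lborel (ball (0::real^'n) 1) *
       set_lebesgue_integral lborel {y. F x y < 1} (\<lambda>y. det (fundamental_tensor F x y))"

text \<open>The indicatrix of a Finsler metric is compact and does not contain \<open>0\<close>, so the supremum
  and infimum below are a maximum and a minimum.\<close>

definition sigma_max :: "(real^'n \<Rightarrow> real^'n \<Rightarrow> real) \<Rightarrow> real^'n \<Rightarrow> real" where
  "sigma_max F x = (SUP y\<in>indicatrix F x. sqrt (det (fundamental_tensor F x y)))"

definition sigma_min :: "(real^'n \<Rightarrow> real^'n \<Rightarrow> real) \<Rightarrow> real^'n \<Rightarrow> real" where
  "sigma_min F x = (INF y\<in>indicatrix F x. sqrt (det (fundamental_tensor F x y)))"

definition area_wrt :: "(real^2 \<Rightarrow> real) \<Rightarrow> (real^2) set \<Rightarrow> real" where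
  "area_wrt \<sigma> D = set_lebesgue_integral lborel D \<sigma>"

text \<open>\<open>\<sigma>\<close> is the density of the volume form with respect to \<open>dx\<close>. Competitors may be
  parametrized on any interval and in either direction.\<close>

definition isoperimetric_solution ::
    "(real^2) set \<Rightarrow> (real^2 \<Rightarrow> real^2 \<Rightarrow> real) \<Rightarrow> (real^2 \<Rightarrow> real) \<Rightarrow>
     real \<Rightarrow> real \<Rightarrow> (real \<Rightarrow> real^2) \<Rightarrow> bool" where
  "isoperimetric_solution M F \<sigma> s0 s1 \<gamma>\<^sub>0 \<longleftrightarrow>
     simple_closed_piecewise_smooth_in M s0 s1 \<gamma>\<^sub>0 \<and>
     (\<forall>t0 t1 \<gamma>. simple_closed_piecewise_smooth_in M t0 t1 \<gamma> \<longrightarrow>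
        finsler_length F t0 t1 \<gamma> = finsler_length F s0 s1 \<gamma>\<^sub>0 \<longrightarrow>
        area_wrt \<sigma> (inside (\<gamma> ` {t0..t1})) \<le> area_wrt \<sigma> (inside (\<gamma>\<^sub>0 ` {s0..s1})))"


definition poincare_disc :: "(real^2) set" where
  "poincare_disc = {x. (x$1)\<^sup>2 + (x$2)\<^sup>2 < 1}"

definition poincare_metric :: "real^2 \<Rightarrow> real^2 \<Rightarrow> real" where
  "poincare_metric x y = 2 * sqrt ((y$1)\<^sup>2 + (y$2)\<^sup>2) / (1 - (x$1)\<^sup>2 - (x$2)\<^sup>2)"

definition poincare_tensor :: "real^2 \<Rightarrow> real^2^2" where
  "poincare_tensor x = (\<chi> i j. if i = j then 4 / (1 - (x$1)\<^sup>2 - (x$2)\<^sup>2)\<^sup>2 else 0)"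

lemma poincare_metric_eq_tensor:
  assumes "x \<in> poincare_disc"
  shows "poincare_metric x y = sqrt (\<Sum>i\<in>UNIV. \<Sum>j\<in>UNIV. poincare_tensor x $ i $ j * y$i * y$j)"
proof -
  define r where "r = 1 - (x$1)\<^sup>2 - (x$2)\<^sup>2"
  have r: "r > 0" using assms by (simp add: r_def poincare_disc_def)
  have A: "poincare_tensor x $ i $ j = (if i = j then 4 / r\<^sup>2 else 0)" for i j
    by (simp add: poincare_tensor_def r_def)
  have "(\<Sum>i\<in>UNIV. \<Sum>j\<in>UNIV. poincare_tensor x $ i $ j * y$i * y$j)
      = (2 / r)\<^sup>2 * ((y$1)\<^sup>2 + (y$2)\<^sup>2)"
    unfolding A sum_2 by (simp add: power2_eq_square algebra_simps add_divide_distrib)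
  then show ?thesis
    using r by (simp add: poincare_metric_def r_def[symmetric] real_sqrt_mult)
qed

definition covector_norm :: "real^'n^'n \<Rightarrow> real^'n \<Rightarrow> real" where
  "covector_norm A b = sqrt (\<Sum>i\<in>UNIV. \<Sum>j\<in>UNIV. matrix_inv A $ i $ j * b$i * b$j)"

text \<open>Coefficients \<open>b\<^sub>i\<close> of \<open>df\<close>.\<close>

definition differential_coeffs :: "(real^'n \<Rightarrow> real) \<Rightarrow> real^'n \<Rightarrow> real^'n" where
  "differential_coeffs f x = (\<chi> i. partial_deriv i f x)"

definition randers_poincare :: "(real^2 \<Rightarrow> real) \<Rightarrow> real^2 \<Rightarrow> real^2 \<Rightarrow> real" where
  "randers_poincare f x y =
     poincare_metric x y + (\<Sum>i\<in>UNIV. differential_coeffs f x $ i * y$i)"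

end

theory Submission
  imports Defs "HOL-Complex_Analysis.Complex_Analysis"
begin

text \<open>Since \<open>\<beta> = df\<close> is exact, the Finsler length of a closed curve is its hyperbolic length
  \<open>L\<close>. Since \<open>\<parallel>\<beta>\<parallel>\<close> is constant, all the norms \<open>F(x, \<cdot>)\<close> are, up to the conformal factor and a rotation,
  one and the same norm on the plane, so each of the four densities is a constant multiple of the
  hyperbolic one. What remains is the hyperbolic isoperimetric inequality \<open>A (4 \<pi> + A) \<le> L\<^sup>2\<close>. It follows
  from the identity
  \<open>A (4 \<pi> + A) = \<integral>\<integral> 4 cnj (z - \<zeta>) / ((z - \<zeta>) (1 - |z|\<^sup>2) (1 - |\<zeta>|\<^sup>2)) dz d\<zeta>\<close>, where \<open>z\<close> and \<open>\<zeta>\<close> both run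
  through the curve: the modulus of the integrand is the product of the two hyperbolic line elements.
  The identity itself comes from writing the kernel as an area integral of Cauchy kernels (a partial
  fraction expansion of the potential of the hyperbolic area measure), exchanging the integrals, and
  using that a simple closed curve has winding number \<open>1\<close> or \<open>-1\<close> around its interior
  points. The geometric content is \<open>cos (\<theta> - \<theta>') \<le> 1\<close> for the angles \<open>\<theta>\<close>, \<open>\<theta>'\<close> between a geodesic
  chord and the tangents at its two ends.\<close>

section \<open>The real plane and the complex plane\<close>

text \<open>The term A^2 is the effect of curvature. Write A as the integral of the density over
  interior points x. Once z is integrated out, each x carries the form (1 - x cnj \<zeta>) / ((x -
  \<zeta>) (1 - |\<zeta>|^2)) d\<zeta>, which splits into 1 / (x - \<zeta>) and - cnj \<zeta> / (1 -
  |\<zeta>|^2). The first part only sees that the curve winds around x and yields 4 pi A; the second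
  is, up to a factor, a primitive of the area form and yields another A. The orientation enters as a
  sign in both integrations and cancels.

  The hyperbolic area of the disc is infinite, so the potential is formed with the density cut off
  at a radius R < 1 that lies beyond the curve; on the curve the result does not depend on R. The
  delicate exchange is that of the integrals over z and x: for fixed \<zeta> the integrand has poles
  in x at z and at \<zeta>, and they merge as z approaches \<zeta>.

  For the circle both sides of the inequality agree, and A (4 pi + A) increases strictly for A \<ge>
  0, which turns equal lengths into a comparison of areas.\<close>

definition to_complex :: "real^2 \<Rightarrow> complex" where
  "to_complex v = Complex (v$1) (v$2)"

definition of_complex :: "complex \<Rightarrow> real^2" where
  "of_complex z = vector [Re z, Im z]"

lemma to_complex_of_complex [simp]: "to_complex (of_complex z) = z"
  by (simp add: to_complex_def of_complex_def)

lemma of_complex_to_complex [simp]: "of_complex (to_complex v) = v"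
  by (simp add: to_complex_def of_complex_def vec_eq_iff forall_2)

lemma of_complex_nth [simp]: "of_complex z $ 1 = Re z" "of_complex z $ 2 = Im z"
  by (simp_all add: of_complex_def)

lemma Re_to_complex [simp]: "Re (to_complex v) = v$1" "Im (to_complex v) = v$2"
  by (simp_all add: to_complex_def)

lemma linear_to_complex: "linear to_complex"
  by (rule linearI) (simp_all add: complex_eq_iff)

lemma linear_of_complex: "linear of_complex"
  by (rule linearI) (simp_all add: vec_eq_iff forall_2)

lemma bounded_linear_to_complex: "bounded_linear to_complex"
  using linear_to_complex linear_conv_bounded_linear by blast

lemma bounded_linear_of_complex: "bounded_linear of_complex"
  using linear_of_complex linear_conv_bounded_linear by blast

lemma norm_to_complex [simp]: "cmod (to_complex v) = norm v"
  by (simp add: cmod_def norm_vec_def L2_set_def sum_2)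

lemma norm_of_complex [simp]: "norm (of_complex z) = cmod z"
  by (metis norm_to_complex to_complex_of_complex)

lemma inj_to_complex: "inj to_complex"
  by (metis injI of_complex_to_complex)

lemma continuous_to_complex [continuous_intros]:
  "continuous_on S f \<Longrightarrow> continuous_on S (\<lambda>x. to_complex (f x))"
  using bounded_linear.continuous_on[OF bounded_linear_to_complex] .

lemma continuous_of_complex [continuous_intros]:
  "continuous_on S f \<Longrightarrow> continuous_on S (\<lambda>x. of_complex (f x))"
  using bounded_linear.continuous_on[OF bounded_linear_of_complex] .

lemma measurable_to_complex [measurable]: "to_complex \<in> borel_measurable borel"
  by (intro borel_measurable_continuous_onI continuous_intros)

lemma measurable_of_complex [measurable]: "of_complex \<in> borel_measurable borel"
  by (intro borel_measurable_continuous_onI continuous_intros)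

lemma vimage_to_complex_box:
  "to_complex -` box l u = box (of_complex l) (of_complex u)"
  by (auto simp: mem_box_cart forall_2 in_box_complex_iff)

lemma distr_to_complex: "distr lborel borel to_complex = lborel"
proof (rule lborel_eqI[symmetric])
  fix l u :: complex assume lu: "\<And>b. b \<in> Basis \<Longrightarrow> l \<bullet> b \<le> u \<bullet> b"
  have le: "Re l \<le> Re u" "Im l \<le> Im u"
    using lu[of 1] lu[of \<i>] by (auto simp: Basis_complex_def)
  have "emeasure (distr lborel borel to_complex) (box l u) = emeasure lborel (box (of_complex l) (of_complex u))"
    by (simp add: emeasure_distr vimage_to_complex_box)
  also have "\<dots> = (\<Prod>b\<in>Basis. (of_complex u - of_complex l) \<bullet> b)"
    using le by (intro emeasure_lborel_box) (auto simp: Basis_vec_def inner_axis forall_2, metis exhaust_2 of_complex_nth)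
  also have "(\<Prod>b\<in>Basis. (of_complex u - of_complex l) \<bullet> b) = (\<Prod>b\<in>Basis. (u - l) \<bullet> b)"
  proof -
    have B: "(Basis :: (real^2) set) = {axis 1 1, axis 2 1}"
      by (auto simp: Basis_vec_def) (metis exhaust_2)
    have "axis (1::2) (1::real) \<noteq> axis 2 1" by (simp add: axis_eq_axis)
    then have "(\<Prod>b\<in>Basis. (of_complex u - of_complex l) \<bullet> b) = (Re u - Re l) * (Im u - Im l)"
      unfolding B by (simp add: inner_axis)
    then show ?thesis by (simp add: Basis_complex_def)
  qed
  finally show "emeasure (distr lborel borel to_complex) (box l u) = (\<Prod>b\<in>Basis. (u - l) \<bullet> b)" .
qed simp

lemma distr_of_complex: "distr lborel borel of_complex = lborel"
proof -
  have "distr lborel borel of_complex = distr (distr lborel borel to_complex) borel of_complex"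
    by (simp add: distr_to_complex)
  also have "\<dots> = distr lborel borel (\<lambda>x. x)"
    by (subst distr_distr) (auto simp: comp_def)
  also have "\<dots> = lborel" by (metis distr_id2 sets_lborel)
  finally show ?thesis .
qed

section \<open>Scaling and rotation as a change of variables\<close>

lemma det_complex_mult:
  "det (matrix (\<lambda>v. of_complex (c * to_complex v))) = (cmod c)\<^sup>2"
  by (simp add: det_2 matrix_def axis_def cmod_power2) (simp add: power2_eq_square)

text \<open>The Jacobian |c|^2 comes from \<open>measure_linear_image\<close>, applied to the same
  map read on \<open>real^2\<close>. The change of variables serves twice: |c| = 1 rotates the
  potential, and \<open>e / l\<close> brings a Randers norm to its normal form.\<close>

lemma lborel_eq_density_complex_mult:
  assumes "c \<noteq> 0"
  shows "lborel = density (distr lborel borel ((*) c)) (\<lambda>_. ennreal ((cmod c)\<^sup>2))"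
proof (rule lborel_eqI)
  fix l u :: complex assume lu: "\<And>b. b \<in> Basis \<Longrightarrow> l \<bullet> b \<le> u \<bullet> b"
  define f where "f = (\<lambda>v. of_complex (c * to_complex v))"
  define S where "S = (\<lambda>v. c * to_complex v) -` box l u"
  have lin: "linear f" unfolding f_def
    by (intro linearI) (auto simp: vec_eq_iff forall_2 algebra_simps)
  have fS: "f ` S = box (of_complex l) (of_complex u)"
  proof -
    have "v \<in> f ` S" if "v \<in> box (of_complex l) (of_complex u)" for v
    proof
      show "v = f (of_complex (to_complex v / c))" using assms by (simp add: f_def)
      have "to_complex v \<in> box l u" using that vimage_to_complex_box by blast
      then show "of_complex (to_complex v / c) \<in> S" using assms by (simp add: S_def)
    qed
    moreover have "f v \<in> box (of_complex l) (of_complex u)" if "v \<in> S" for v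
      using that vimage_to_complex_box[of l u] by (auto simp: S_def f_def)
    ultimately show ?thesis by auto
  qed
  have "open S" unfolding S_def by (intro open_vimage continuous_intros) auto
  moreover have "bounded S"
  proof -
    have "S \<subseteq> (\<lambda>z. of_complex (z / c)) ` box l u"
    proof
      fix v assume "v \<in> S"
      then have "c * to_complex v \<in> box l u" by (simp add: S_def)
      moreover have "v = of_complex (c * to_complex v / c)" using assms by simp
      ultimately show "v \<in> (\<lambda>z. of_complex (z / c)) ` box l u" by blast
    qed
    moreover have "bounded ((\<lambda>z. of_complex (z / c)) ` box l u)"
      by (intro bounded_linear_image bounded_box bounded_linear_compose[OF bounded_linear_of_complex] bounded_linear_divide)
    ultimately show ?thesis using bounded_subset by blast
  qed
  ultimately have S: "S \<in> lmeasurable" by (simp add: lmeasurable_open)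
  have m: "measure lebesgue (f ` S) = (cmod c)\<^sup>2 * measure lebesgue S"
    using measure_linear_image[OF lin S] det_complex_mult[of c] by (simp add: f_def)
  have bS: "S \<in> sets borel" using \<open>open S\<close> by simp
  have "emeasure lborel (box l u) = emeasure lborel (f ` S)"
    unfolding fS vimage_to_complex_box[symmetric]
    by (subst distr_to_complex[symmetric]) (simp add: emeasure_distr)
  also have "\<dots> = ennreal (measure lborel (f ` S))"
    unfolding fS by (intro emeasure_eq_ennreal_measure) (metis emeasure_lborel_box_finite less_top infinity_ennreal_def)
  also have "measure lborel (f ` S) = (cmod c)\<^sup>2 * measure lborel S"
    using m bS by (simp add: fS measure_completion)
  also have "ennreal \<dots> = ennreal ((cmod c)\<^sup>2) * emeasure lborel S"
    using S bS by (simp add: ennreal_mult' emeasure_eq_ennreal_measure fmeasurable_def)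
  also have "emeasure lborel S = emeasure (distr lborel borel ((*) c)) (box l u)"
  proof -
    have "emeasure (distr lborel borel ((*) c)) (box l u) = emeasure lborel ((*) c -` box l u)"
      by (subst emeasure_distr) auto
    also have "\<dots> = emeasure lborel (to_complex -` ((*) c -` box l u))"
      by (subst distr_to_complex[symmetric], subst emeasure_distr) 
         (auto intro!: borel_open open_vimage continuous_intros)
    finally show ?thesis by (simp add: S_def vimage_def)
  qed
  finally show "emeasure (density (distr lborel borel ((*) c)) (\<lambda>_. ennreal ((cmod c)\<^sup>2))) (box l u) = (\<Prod>b\<in>Basis. (u - l) \<bullet> b)"
    using emeasure_lborel_box[of l u] lu by (simp add: emeasure_density_const)
qed simp

lemma integrable_complex_mult:
  fixes f :: "complex \<Rightarrow> 'b::{banach,second_countable_topology}"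
  assumes "c \<noteq> 0" and [measurable]: "f \<in> borel_measurable borel"
  shows "integrable lborel (\<lambda>x. f (c * x)) \<longleftrightarrow> integrable lborel f"
proof -
  have "integrable lborel f \<longleftrightarrow> integrable lborel (\<lambda>x. (cmod c)\<^sup>2 *\<^sub>R f (c * x))"
    by (subst lborel_eq_density_complex_mult[OF assms(1)])
       (simp add: integrable_density integrable_distr_eq)
  also have "\<dots> \<longleftrightarrow> integrable lborel (\<lambda>x. f (c * x))"
  proof
    assume "integrable lborel (\<lambda>x. (cmod c)\<^sup>2 *\<^sub>R f (c * x))"
    from integrable_scaleR_right[OF this, of "1 / (cmod c)\<^sup>2"]
    show "integrable lborel (\<lambda>x. f (c * x))" using assms(1) by simp
  qed (rule integrable_scaleR_right)
  finally show ?thesis ..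
qed

lemma integral_complex_mult:
  fixes f :: "complex \<Rightarrow> 'b::{banach,second_countable_topology}"
  assumes "c \<noteq> 0" and [measurable]: "f \<in> borel_measurable borel"
  shows "integral\<^sup>L lborel f = (cmod c)\<^sup>2 *\<^sub>R (\<integral>x. f (c * x) \<partial>lborel)"
  by (subst lborel_eq_density_complex_mult[OF assms(1)])
     (simp add: integral_density integral_distr)

section \<open>Radial integrals\<close>

lemma ball_borel [measurable]: "ball c r \<in> sets borel"
  by (rule borel_open) simp

text \<open>In the variable |x|^2 the area of the plane has the constant density pi, so this image
  measure takes the place of polar coordinates. Both measures are finite on rays and hence
  determined by them; \<open>max 0 a\<close> covers the rays that start below 0.\<close>

lemma distr_cmod_square:
  assumes "r \<ge> 0"
  shows "distr (density lborel (indicator (ball (0::complex) r))) borel (\<lambda>x. (cmod x)\<^sup>2)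
       = density lborel (\<lambda>u. ennreal pi * indicator {0<..<r\<^sup>2} u)" (is "?M = ?N")
proof (rule measure_eqI_lessThan)
  have V [measurable]: "(\<lambda>x::complex. (cmod x)\<^sup>2) -` {a<..} \<in> sets borel" for a
    by (intro borel_open open_vimage continuous_intros) 
  have M: "emeasure ?M {a<..} = ennreal (pi * (r\<^sup>2 - max 0 a))" if "a < r\<^sup>2" for a
  proof -
    have "emeasure ?M {a<..} = (\<integral>\<^sup>+x. indicator (ball 0 r) x * indicator ((\<lambda>x::complex. (cmod x)\<^sup>2) -` {a<..}) x \<partial>lborel)"
      by (subst emeasure_distr) (simp_all add: emeasure_density)
    also have "\<dots> = emeasure lborel (ball 0 r \<inter> (\<lambda>x::complex. (cmod x)\<^sup>2) -` {a<..})"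
      unfolding indicator_inter_arith[symmetric] by (rule nn_integral_indicator) measurable
    also have "\<dots> = ennreal (pi * (r\<^sup>2 - max 0 a))"
    proof (cases "a < 0")
      case True
      have "x \<in> (\<lambda>x::complex. (cmod x)\<^sup>2) -` {a<..}" for x
        using True by (simp add: less_le_trans)
      then have "ball 0 r \<inter> (\<lambda>x::complex. (cmod x)\<^sup>2) -` {a<..} = ball 0 r" by blast
      then show ?thesis using True assms by (simp add: emeasure_ball unit_ball_vol_2)
    next
      case False
      have lr: "sqrt a \<le> r" "a \<le> r^2" using that assms False by (auto intro!: real_le_lsqrt)
      have "ball 0 r \<inter> (\<lambda>x::complex. (cmod x)\<^sup>2) -` {a<..} = ball 0 r - cball 0 (sqrt a)"
        using False by (auto simp: not_le real_sqrt_less_iff real_less_rsqrt dest: real_sqrt_less_mono) (metis real_sqrt_less_iff real_sqrt_abs abs_norm_cancel)+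
      moreover have "emeasure lborel (ball 0 r - cball 0 (sqrt a) :: complex set) = ennreal (pi * (r\<^sup>2 - a))"
      proof (cases "sqrt a = r")
        case True
        then have "a = r\<^sup>2" using False by auto
        then show ?thesis using that by simp
      next
        case ne: False
        then have "sqrt a < r" using lr by simp
        then have "emeasure lborel (ball 0 r - cball 0 (sqrt a) :: complex set) =
           emeasure lborel (ball 0 r :: complex set) - emeasure lborel (cball 0 (sqrt a) :: complex set)"
          using False by (intro emeasure_Diff) (auto simp: emeasure_cball)
        also have "\<dots> = ennreal (pi * (r\<^sup>2 - a))"
          using False assms lr by (simp add: emeasure_ball emeasure_cball unit_ball_vol_2 ennreal_minus algebra_simps)
        finally show ?thesis .
      qed
      ultimately show ?thesis using False by simp
    qed
    finally show ?thesis .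
  qed
  have M0: "emeasure ?M {a<..} = 0" if "a \<ge> r\<^sup>2" for a
  proof -
    have "ball 0 r \<inter> (\<lambda>x::complex. (cmod x)\<^sup>2) -` {a<..} = {}"
      using that assms by (auto simp: not_less) (smt (verit) norm_ge_zero power_mono)
    then have "AE x in lborel. indicator (ball 0 r) x * indicator ((\<lambda>x::complex. (cmod x)\<^sup>2) -` {a<..}) x = (0::ennreal)"
      by (intro AE_I2) (auto simp: indicator_def)
    then show ?thesis
      by (subst emeasure_distr) (auto simp: emeasure_density nn_integral_0_iff_AE)
  qed
  have N: "emeasure ?N {a<..} = ennreal (pi * (r\<^sup>2 - max 0 a))" if "a < r\<^sup>2" for a
  proof -
    have "emeasure ?N {a<..} = (\<integral>\<^sup>+u. ennreal pi * indicator {max 0 a<..<r\<^sup>2} u \<partial>lborel)"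
      by (subst emeasure_density) (auto intro!: nn_integral_cong simp: indicator_def)
    also have "\<dots> = ennreal (pi * (r\<^sup>2 - max 0 a))"
      using that by (subst nn_integral_cmult_indicator) (auto simp: ennreal_mult)
    finally show ?thesis .
  qed
  have N0: "emeasure ?N {a<..} = 0" if "a \<ge> r\<^sup>2" for a
  proof -
    have *: "ennreal pi * indicator {0<..<r\<^sup>2} u * indicator {a<..} u = (0::ennreal)" for u
      using that by (auto simp: indicator_def)
    have "emeasure ?N {a<..} = (\<integral>\<^sup>+u. 0 \<partial>(lborel::real measure))"
      by (subst emeasure_density) (simp, simp, simp only: *)
    then show ?thesis by simp
  qed
  show "emeasure ?M {a<..} = emeasure ?N {a<..}" for a
    using M[of a] N[of a] M0[of a] N0[of a] by (cases "a < r\<^sup>2") auto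
  show "emeasure ?M {a<..} < \<infinity>" for a
    using M[of a] M0[of a] by (cases "a < r\<^sup>2") auto
qed simp_all

lemma nn_integral_radial:
  assumes "r \<ge> 0" and [measurable]: "f \<in> borel_measurable borel"
  shows "(\<integral>\<^sup>+x. f ((cmod x)\<^sup>2) * indicator (ball 0 r) x \<partial>lborel)
       = ennreal pi * (\<integral>\<^sup>+u. f u * indicator {0..r\<^sup>2} u \<partial>lborel)"
proof -
  have "(\<integral>\<^sup>+x. f ((cmod x)\<^sup>2) * indicator (ball 0 r) x \<partial>lborel)
      = (\<integral>\<^sup>+u. f u \<partial>distr (density lborel (indicator (ball (0::complex) r))) borel (\<lambda>x. (cmod x)\<^sup>2))"
    by (subst nn_integral_distr, measurable, subst nn_integral_density, measurable, simp add: mult.commute)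
  also have "\<dots> = (\<integral>\<^sup>+u. ennreal pi * (f u * indicator {0<..<r\<^sup>2} u) \<partial>lborel)"
    unfolding distr_cmod_square[OF assms(1)] by (simp add: nn_integral_density ac_simps)
  also have "\<dots> = ennreal pi * (\<integral>\<^sup>+u. f u * indicator {0<..<r\<^sup>2} u \<partial>lborel)"
    by (intro nn_integral_cmult) auto
  \<comment> \<open>End points form a null set; the closed interval is the one that
    \<open>nn_integral_FTC_Icc\<close> works with.\<close>
  also have "(\<integral>\<^sup>+u. f u * indicator {0<..<r\<^sup>2} u \<partial>lborel) = (\<integral>\<^sup>+u. f u * indicator {0..r\<^sup>2} u \<partial>lborel)"
  proof (rule nn_integral_cong_AE)
    have "AE u in lborel. u \<noteq> (0::real)" "AE u in lborel. u \<noteq> r\<^sup>2"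
      by (simp_all add: AE_lborel_singleton)
    then show "AE u in lborel. f u * indicator {0<..<r\<^sup>2} u = f u * indicator {0..r\<^sup>2} u"
      by eventually_elim (auto simp: indicator_def)
  qed
  finally show ?thesis .
qed

text \<open>The area density of the Poincare metric: the square of its conformal factor 2 / (1 -
  |x|^2).\<close>

definition hyp_density :: "complex \<Rightarrow> real" where
  "hyp_density x = 4 / (1 - (cmod x)\<^sup>2)\<^sup>2"

lemma measurable_hyp_density [measurable]: "hyp_density \<in> borel_measurable borel"
  unfolding hyp_density_def[abs_def] by measurable

lemma hyp_density_nonneg: "hyp_density x \<ge> 0"
  by (simp add: hyp_density_def)

lemma nn_integral_hyp_density_ball:
  assumes "0 \<le> r" "r < 1"
  shows "(\<integral>\<^sup>+x. ennreal (hyp_density x) * indicator (ball 0 r) x \<partial>lborel)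
       = ennreal (4 * pi * r\<^sup>2 / (1 - r\<^sup>2))"
proof -
  have r2: "r\<^sup>2 < 1" using assms by (simp add: power_less_one_iff abs_square_less_1)
  have "(\<integral>\<^sup>+x. ennreal (hyp_density x) * indicator (ball 0 r) x \<partial>lborel)
      = ennreal pi * (\<integral>\<^sup>+u. ennreal (4 / (1 - u)\<^sup>2) * indicator {0..r\<^sup>2} u \<partial>lborel)"
    unfolding hyp_density_def using assms by (subst nn_integral_radial[symmetric]) auto
  also have "(\<integral>\<^sup>+u. ennreal (4 / (1 - u)\<^sup>2) * indicator {0..r\<^sup>2} u \<partial>lborel) = ennreal (4 / (1 - r\<^sup>2) - 4 / (1 - 0))"
    by (rule nn_integral_FTC_Icc)
       (use r2 in \<open>auto intro!: derivative_eq_intros simp: power2_eq_square\<close>)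
  also have "ennreal pi * \<dots> = ennreal (4 * pi * r\<^sup>2 / (1 - r\<^sup>2))"
    using r2 by (subst ennreal_mult'[symmetric]) (auto simp: field_simps)
  finally show ?thesis .
qed

lemma integral_hyp_density_ball:
  assumes "0 \<le> r" "r < 1"
  shows "integrable lborel (\<lambda>x. hyp_density x * indicator (ball 0 r) x)"
    and "(\<integral>x. hyp_density x * indicator (ball 0 r) x \<partial>lborel) = 4 * pi * r\<^sup>2 / (1 - r\<^sup>2)"
proof -
  have r2: "r\<^sup>2 < 1" using assms by (simp add: power_less_one_iff abs_square_less_1)
  have "(\<integral>\<^sup>+x. ennreal (hyp_density x * indicator (ball 0 r) x) \<partial>lborel) = ennreal (4 * pi * r\<^sup>2 / (1 - r\<^sup>2))"
    using nn_integral_hyp_density_ball[OF assms]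
    by (simp add: ennreal_mult' hyp_density_nonneg ennreal_indicator)
  moreover have "0 \<le> 4 * pi * r\<^sup>2 / (1 - r\<^sup>2)" using r2 by simp
  ultimately have "has_bochner_integral lborel (\<lambda>x. hyp_density x * indicator (ball 0 r) x) (4 * pi * r\<^sup>2 / (1 - r\<^sup>2))"
    by (intro has_bochner_integral_nn_integral) (auto simp: hyp_density_nonneg)
  then show "integrable lborel (\<lambda>x. hyp_density x * indicator (ball 0 r) x)"
    and "(\<integral>x. hyp_density x * indicator (ball 0 r) x \<partial>lborel) = 4 * pi * r\<^sup>2 / (1 - r\<^sup>2)"
    by (simp_all add: has_bochner_integral_iff)
qed

text \<open>The exponent -3/2 is above -2, hence integrable in the plane, and below -1, hence it
  dominates 1 / r near 0. Enlarging the unit disc to \<open>ball \<zeta> 2\<close> makes the bound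
  uniform in \<open>\<zeta>\<close>. The integral over that ball is 4 pi sqrt 2; the stated constant
  is rounded up.\<close>

lemma nn_integral_norm_powr_bound:
  fixes \<zeta> :: complex
  assumes "cmod \<zeta> < 1"
  shows "(\<integral>\<^sup>+x. ennreal (cmod (x - \<zeta>) powr (-3/2)) * indicator (ball 0 1) x \<partial>lborel) \<le> ennreal (8 * pi * sqrt 2)"
proof -
  have "(\<integral>\<^sup>+x. ennreal (cmod (x - \<zeta>) powr (-3/2)) * indicator (ball 0 1) x \<partial>lborel)
     \<le> (\<integral>\<^sup>+x. ennreal (cmod (x - \<zeta>) powr (-3/2)) * indicator (ball \<zeta> 2) x \<partial>lborel)"
  proof (intro nn_integral_mono mult_left_mono)
    fix x
    have "dist \<zeta> x < 2" if "cmod x < 1"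
      using assms that norm_triangle_ineq4[of \<zeta> x] by (simp add: dist_norm)
    then show "indicator (ball 0 1) x \<le> (indicator (ball \<zeta> 2) x :: ennreal)"
      by (auto simp: indicator_def)
  qed simp
  also have "\<dots> = (\<integral>\<^sup>+x. ennreal (cmod (x - \<zeta>) powr (-3/2)) * indicator (ball \<zeta> 2) x \<partial>distr lborel borel ((+) \<zeta>))"
    by (simp add: lborel_distr_plus)
  also have "\<dots> = (\<integral>\<^sup>+x. ennreal (cmod x powr (-3/2)) * indicator (ball 0 2) x \<partial>lborel)"
    by (subst nn_integral_distr) (auto simp: indicator_def dist_norm)
  also have "\<dots> = (\<integral>\<^sup>+x. ennreal (((cmod x)\<^sup>2) powr (-3/4)) * indicator (ball 0 2) x \<partial>lborel)"
  proof (intro nn_integral_cong)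
    fix x :: complex
    have "((cmod x)\<^sup>2) powr (-3/4) = cmod x powr (-3/2)"
      by (cases "x = 0") (simp_all add: powr_powr flip: powr_numeral)
    then show "ennreal (cmod x powr (-3/2)) * indicator (ball 0 2) x = ennreal (((cmod x)\<^sup>2) powr (-3/4)) * indicator (ball 0 2) x"
      by simp
  qed
  also have "\<dots> = ennreal pi * (\<integral>\<^sup>+u. ennreal (u powr (-3/4)) * indicator {0..2\<^sup>2} u \<partial>lborel)"
    by (rule nn_integral_radial) auto
  also have "(\<integral>\<^sup>+u. ennreal (u powr (-3/4)) * indicator {0..2\<^sup>2} u \<partial>lborel) = ennreal (4 powr (1/4) / (1/4))"
    using nn_integral_has_integral_lebesgue[OF _ has_integral_powr_from_0[of "-3/4" 4]]
    by (simp add: mult.commute ennreal_mult' ennreal_indicator)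
  also have "ennreal pi * \<dots> = ennreal (4 * pi * 4 powr (1/4))"
    by (subst ennreal_mult'[symmetric]) auto
  also have "4 * pi * 4 powr (1/4) \<le> 8 * pi * sqrt 2" 
  proof -
    have "4 powr (1/4) \<le> (4::real) powr (1/2)" by (intro powr_mono) auto
    then have "4 powr (1/4) \<le> (2::real)" by (simp add: powr_half_sqrt)
    moreover have "1 \<le> sqrt (2::real)" by simp
    ultimately have "4 powr (1/4) \<le> 2 * sqrt (2::real)" by linarith
    then show ?thesis by simp
  qed
  finally show ?thesis by (simp add: ennreal_leI)
qed

section \<open>The potential of the hyperbolic density\<close>

text \<open>Cauchy's formula at the centre: along the unit circle du / u is the constant 2 pi i
  dt.\<close>

lemma has_integral_circle_mean:
  assumes "f holomorphic_on cball 0 1"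
  shows "((\<lambda>t. f (exp (2 * of_real pi * \<i> * of_real t))) has_integral f 0) {0..1}"
proof -
  have "((\<lambda>u. f u / (u - 0)) has_contour_integral (2 * of_real pi * \<i> * f 0)) (circlepath 0 1)"
    using assms by (intro Cauchy_integral_circlepath_simple) auto
  then have "((\<lambda>t. f (exp (2 * of_real pi * \<i> * of_real t)) * (2 * of_real pi * \<i>)) has_integral (2 * of_real pi * \<i> * f 0)) {0..1}"
    unfolding has_contour_integral_def
    by (rule has_integral_eq[rotated])
      (simp only: vector_derivative_circlepath01 atLeastAtMost_iff, simp add: circlepath)
  from has_integral_mult_right[OF this, of "1 / (2 * of_real pi * \<i>)"]
  show ?thesis by simp
qed

text \<open>As a function of w, 1 / (z - w x) has no pole in the closed unit disc, so its mean over
  the circle is its value at w = 0.\<close>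

lemma has_integral_inverse_circle_inside:
  assumes "cmod x < cmod z"
  shows "((\<lambda>t. 1 / (z - exp (2 * of_real pi * \<i> * of_real t) * x)) has_integral 1 / z) {0..1}"
proof -
  have "z - w * x \<noteq> 0" if "cmod w \<le> 1" for w
  proof
    assume "z - w * x = 0"
    then have "cmod z = cmod w * cmod x" by (simp flip: norm_mult)
    also have "\<dots> \<le> cmod x" using that by (simp add: mult_left_le_one_le)
    finally show False using assms by simp
  qed
  then have "(\<lambda>w. 1 / (z - w * x)) holomorphic_on cball 0 1"
    by (intro holomorphic_intros) auto
  from has_integral_circle_mean[OF this] show ?thesis by simp
qed

text \<open>Here 1 / (z - w x) does have a pole in the disc. On |w| = 1, however, it is the
  conjugate of w / (cnj z w - cnj x), which is holomorphic on the closed disc and vanishes at w =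
  0.\<close>

lemma has_integral_inverse_circle_outside:
  assumes "cmod z < cmod x"
  shows "((\<lambda>t. 1 / (z - exp (2 * of_real pi * \<i> * of_real t) * x)) has_integral 0) {0..1}"
proof -
  have "cnj z * w - cnj x \<noteq> 0" if "cmod w \<le> 1" for w
  proof
    assume "cnj z * w - cnj x = 0"
    then have "cmod (cnj x) = cmod (cnj z * w)" by simp
    then have "cmod x = cmod z * cmod w" by (simp add: norm_mult)
    also have "\<dots> \<le> cmod z" using that by (simp add: mult_right_le_one_le)
    finally show False using assms by simp
  qed
  then have "(\<lambda>w. w / (cnj z * w - cnj x)) holomorphic_on cball 0 1"
    by (intro holomorphic_intros) auto
  from has_integral_circle_mean[OF this]
  have "((\<lambda>t. exp (2 * of_real pi * \<i> * of_real t) / (cnj z * exp (2 * of_real pi * \<i> * of_real t) - cnj x)) has_integral 0) {0..1}"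
    by simp
  then have "((\<lambda>t. cnj (exp (2 * of_real pi * \<i> * of_real t) / (cnj z * exp (2 * of_real pi * \<i> * of_real t) - cnj x))) has_integral cnj 0) {0..1}"
    by (drule_tac has_integral_linear[OF _ bounded_linear_cnj]) (simp only: o_def)
  moreover have "cnj (w / (cnj z * w - cnj x)) = 1 / (z - w * x)" if "cmod w = 1" for w
  proof -
    have "w * cnj w = 1" using that by (simp add: complex_norm_square[symmetric])
    then have "cnj w \<noteq> 0" and "z * cnj w - x = cnj w * (z - w * x)" by (auto simp: algebra_simps)
    then show ?thesis by simp
  qed
  ultimately show ?thesis by (simp add: )
qed

text \<open>The cut-off makes the density bounded and integrable without changing it on a curve, or
  inside one, that lies in \<open>ball 0 R\<close>.\<close>

definition trunc_density :: "real \<Rightarrow> complex \<Rightarrow> real" where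
  "trunc_density R x = hyp_density x * indicator (ball 0 R) x"

lemma measurable_trunc_density [measurable]: "trunc_density R \<in> borel_measurable borel"
  unfolding trunc_density_def[abs_def] by measurable

lemma trunc_density_nonneg: "trunc_density R x \<ge> 0"
  by (simp add: trunc_density_def hyp_density_nonneg)

lemma trunc_density_rotate: "cmod c = 1 \<Longrightarrow> trunc_density R (c * x) = trunc_density R x"
  by (simp add: trunc_density_def hyp_density_def norm_mult indicator_def)

section \<open>Weakly singular integrals against the cut-off density\<close>

lemma trunc_density_le:
  assumes "0 \<le> R" "R < 1"
  shows "trunc_density R x \<le> 4 / (1 - R\<^sup>2)\<^sup>2 * indicator (ball 0 1) x"
proof (cases "cmod x < R")
  case True
  then have "(cmod x)\<^sup>2 \<le> R\<^sup>2" "R\<^sup>2 < 1" using assms by (auto intro!: power_mono simp: abs_square_less_1)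
  then have "(1 - R\<^sup>2)\<^sup>2 \<le> (1 - (cmod x)\<^sup>2)\<^sup>2" "0 < (1 - R\<^sup>2)\<^sup>2" by (auto intro!: power_mono)
  then have "4 / (1 - (cmod x)\<^sup>2)\<^sup>2 \<le> 4 / (1 - R\<^sup>2)\<^sup>2" by (intro divide_left_mono mult_pos_pos) linarith+
  then show ?thesis using True assms by (simp add: trunc_density_def hyp_density_def)
qed (simp add: trunc_density_def)

lemma integrable_trunc_density:
  assumes "0 \<le> R" "R < 1"
  shows "integrable lborel (trunc_density R)"
  using integral_hyp_density_ball(1)[OF assms] by (simp add: trunc_density_def[abs_def])

lemma nn_integral_trunc_density_powr:
  assumes "0 \<le> R" "R < 1" "cmod \<zeta> < 1"
  shows "(\<integral>\<^sup>+x. ennreal (trunc_density R x * cmod (x - \<zeta>) powr (-3/2)) \<partial>lborel)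
     \<le> ennreal (4 / (1 - R\<^sup>2)\<^sup>2 * (8 * pi * sqrt 2))"
proof -
  have "(\<integral>\<^sup>+x. ennreal (trunc_density R x * cmod (x - \<zeta>) powr (-3/2)) \<partial>lborel)
     \<le> (\<integral>\<^sup>+x. ennreal (4 / (1 - R\<^sup>2)\<^sup>2) * (ennreal (cmod (x - \<zeta>) powr (-3/2)) * indicator (ball 0 1) x) \<partial>lborel)"
  proof (rule nn_integral_mono)
    fix x
    have "trunc_density R x * cmod (x - \<zeta>) powr (-3/2) \<le> 4 / (1 - R\<^sup>2)\<^sup>2 * (cmod (x - \<zeta>) powr (-3/2) * indicator (ball 0 1) x)"
      using mult_right_mono[OF trunc_density_le[OF assms(1,2)], of "cmod (x - \<zeta>) powr (-3/2)" x]
      by (simp add: mult_ac)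
    then have "ennreal (trunc_density R x * cmod (x - \<zeta>) powr (-3/2)) \<le> ennreal (4 / (1 - R\<^sup>2)\<^sup>2 * (cmod (x - \<zeta>) powr (-3/2) * indicator (ball 0 1) x))"
      by (rule ennreal_leI)
    also have "\<dots> = ennreal (4 / (1 - R\<^sup>2)\<^sup>2) * (ennreal (cmod (x - \<zeta>) powr (-3/2)) * indicator (ball 0 1) x)"
      by (subst ennreal_mult', simp, subst ennreal_mult') (simp_all add: ennreal_indicator)
    finally show "ennreal (trunc_density R x * cmod (x - \<zeta>) powr (-3/2)) \<le> ennreal (4 / (1 - R\<^sup>2)\<^sup>2) * (ennreal (cmod (x - \<zeta>) powr (-3/2)) * indicator (ball 0 1) x)" .
  qed
  also have "\<dots> = ennreal (4 / (1 - R\<^sup>2)\<^sup>2) * (\<integral>\<^sup>+x. ennreal (cmod (x - \<zeta>) powr (-3/2)) * indicator (ball 0 1) x \<partial>lborel)"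
    by (rule nn_integral_cmult) measurable
  also have "\<dots> \<le> ennreal (4 / (1 - R\<^sup>2)\<^sup>2) * ennreal (8 * pi * sqrt 2)"
    by (intro mult_left_mono nn_integral_norm_powr_bound assms) auto
  also have "\<dots> = ennreal (4 / (1 - R\<^sup>2)\<^sup>2 * (8 * pi * sqrt 2))"
    by (rule ennreal_mult[symmetric]) auto
  finally show ?thesis .
qed

lemma integrable_trunc_density_powr:
  assumes "0 \<le> R" "R < 1" "cmod \<zeta> < 1"
  shows "integrable lborel (\<lambda>x. trunc_density R x * cmod (x - \<zeta>) powr (-3/2))"
proof (rule integrableI_nonneg)
  show "(\<integral>\<^sup>+x. ennreal (trunc_density R x * cmod (x - \<zeta>) powr (-3/2)) \<partial>lborel) < \<infinity>"
    using nn_integral_trunc_density_powr[OF assms] by (rule le_less_trans) simp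
qed (auto simp: trunc_density_nonneg)

lemma integral_trunc_density_powr:
  assumes "0 \<le> R" "R < 1" "cmod \<zeta> < 1"
  shows "(\<integral>x. trunc_density R x * cmod (x - \<zeta>) powr (-3/2) \<partial>lborel) \<le> 4 / (1 - R\<^sup>2)\<^sup>2 * (8 * pi * sqrt 2)"
  using nn_integral_trunc_density_powr[OF assms]
  by (subst (asm) nn_integral_eq_integral[OF integrable_trunc_density_powr[OF assms]])
     (auto simp: trunc_density_nonneg ennreal_le_iff)

text \<open>For r < 1 the power alone suffices, for r \<ge> 1 the summand 1 does; at r = 0 the left
  side is 0 by convention. This reduces the Cauchy kernel to the exponent -3/2, which is treated
  already.\<close>

lemma inverse_le_powr:
  assumes "0 \<le> (r::real)"
  shows "1 / r \<le> 1 + r powr (-3/2)"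
proof (cases "r \<ge> 1 \<or> r = 0")
  case True
  then have "1 / r \<le> 1" by auto
  then show ?thesis using powr_ge_zero[of r "-3/2"] by linarith
next
  case False
  then have "r powr (-1) \<le> r powr (-3/2)" using assms by (intro powr_mono') auto
  then show ?thesis using False assms by (simp add: powr_minus_divide)
qed

text \<open>The bound in the second claim is independent of \<open>\<zeta>\<close>, so it can be
  integrated along a curve; \<open>fubini_kernel\<close> rests on this.\<close>

lemma integrable_trunc_density_div:
  assumes "0 \<le> R" "R < 1" "cmod \<zeta> < 1"
  shows "integrable lborel (\<lambda>x. trunc_density R x / cmod (x - \<zeta>))" 
    and "(\<integral>x. trunc_density R x / cmod (x - \<zeta>) \<partial>lborel)
      \<le> (\<integral>x. trunc_density R x \<partial>lborel) + 4 / (1 - R\<^sup>2)\<^sup>2 * (8 * pi * sqrt 2)"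
proof -
  have le: "trunc_density R x / cmod (x - \<zeta>) \<le> trunc_density R x + trunc_density R x * cmod (x - \<zeta>) powr (-3/2)" for x
    using mult_left_mono[OF inverse_le_powr[of "cmod (x - \<zeta>)"], of "trunc_density R x"]
    by (simp add: trunc_density_nonneg algebra_simps)
  have int: "integrable lborel (\<lambda>x. trunc_density R x + trunc_density R x * cmod (x - \<zeta>) powr (-3/2))"
    using integrable_trunc_density[OF assms(1,2)] integrable_trunc_density_powr[OF assms] by simp
  show *: "integrable lborel (\<lambda>x. trunc_density R x / cmod (x - \<zeta>))"
    by (rule Bochner_Integration.integrable_bound[OF int])
       (use le in \<open>auto simp: trunc_density_nonneg intro!: order_trans[OF _ abs_ge_self]\<close>)
  have "(\<integral>x. trunc_density R x / cmod (x - \<zeta>) \<partial>lborel)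
     \<le> (\<integral>x. trunc_density R x + trunc_density R x * cmod (x - \<zeta>) powr (-3/2) \<partial>lborel)"
    by (rule integral_mono[OF * int le])
  also have "\<dots> = (\<integral>x. trunc_density R x \<partial>lborel) + (\<integral>x. trunc_density R x * cmod (x - \<zeta>) powr (-3/2) \<partial>lborel)"
    using integrable_trunc_density[OF assms(1,2)] integrable_trunc_density_powr[OF assms] by simp
  finally show "(\<integral>x. trunc_density R x / cmod (x - \<zeta>) \<partial>lborel)
      \<le> (\<integral>x. trunc_density R x \<partial>lborel) + 4 / (1 - R\<^sup>2)\<^sup>2 * (8 * pi * sqrt 2)"
    using integral_trunc_density_powr[OF assms] by linarith
qed

lemma AE_cmod_neq: "AE x in lborel. cmod x \<noteq> r"
proof (rule AE_I')
  have "negligible (sphere (0::complex) r)"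
    using negligible_convex_frontier[of "cball (0::complex) r"] by (cases "r = 0") (auto simp: frontier_cball)
  then show "sphere (0::complex) r \<in> null_sets lborel"
    by (simp add: negligible_iff_null_sets null_sets_completion_iff)
qed auto

lemma has_integral_imp_lborel_integral:
  fixes f :: "real \<Rightarrow> complex"
  assumes "continuous_on {a..b} f" "(f has_integral I) {a..b}"
  shows "(\<integral>t. indicator {a..b} t *\<^sub>R f t \<partial>lborel) = I"
  using set_borel_integral_eq_integral(2)[OF borel_integrable_atLeastAtMost'[OF assms(1)]] assms(2)
  by (simp add: set_lebesgue_integral_def integral_unique)

lemma integral_circle_inverse:
  assumes "cmod x \<noteq> cmod z"
  shows "(\<integral>t. indicator {0..1} t *\<^sub>R (1 / (z - exp (2 * of_real pi * \<i> * of_real t) * x)) \<partial>lborel)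
      = (if cmod x < cmod z then 1 / z else 0)"
proof (rule has_integral_imp_lborel_integral)
  have "z - exp (2 * of_real pi * \<i> * of_real t) * x \<noteq> 0" for t
  proof
    assume "z - exp (2 * of_real pi * \<i> * of_real t) * x = 0"
    then have "cmod z = cmod (exp (2 * of_real pi * \<i> * of_real t) * x)" by simp
    then show False using assms by (simp add: norm_mult norm_exp_eq_Re)
  qed
  then show "continuous_on {0..1} (\<lambda>t. 1 / (z - exp (2 * of_real pi * \<i> * of_real t) * x))"
    by (intro continuous_intros) auto
qed (use assms has_integral_inverse_circle_inside has_integral_inverse_circle_outside in auto)

lemma integrable_trunc_density_kernel:
  assumes "0 \<le> R" "R < 1" "cmod z < 1"
  shows "integrable lborel (\<lambda>x. of_real (trunc_density R x) / (z - x))"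
  by (rule Bochner_Integration.integrable_bound[OF integrable_trunc_density_div(1)[OF assms]])
     (auto simp: norm_divide trunc_density_nonneg norm_minus_commute)

text \<open>Averaging over rotations replaces \<open>1 / (z - x)\<close> by \<open>1 / z\<close> if \<open>|x| < |z|\<close> and by \<open>0\<close> if \<open>|x| > |z|\<close>, as in
  Newton's shell theorem.\<close>

lemma hyp_potential:
  fixes z :: complex
  assumes "0 \<le> R" "R < 1" "cmod z < R"
  shows "(\<integral>x. of_real (trunc_density R x) / (z - x) \<partial>lborel) = 4 * pi * cnj z / (1 - (cmod z)\<^sup>2)"
proof -
  define f where "f = (\<lambda>x. of_real (trunc_density R x) / (z - x))"
  define U where "U = (\<integral>x. f x \<partial>lborel)"
  define w where "w = (\<lambda>t::real. exp (2 * of_real pi * \<i> * of_real t))"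
  have [measurable]: "f \<in> borel_measurable borel" unfolding f_def by measurable
  have [measurable]: "w \<in> borel_measurable borel" unfolding w_def by measurable
  have z1: "cmod z < 1" using assms by simp
  \<comment> \<open>The density is radial, so a rotation of x only moves the pole.\<close>
  have rot: "U = (\<integral>x. of_real (trunc_density R x) / (z - c * x) \<partial>lborel)" if "cmod c = 1" for c
  proof -
    have "U = (\<integral>x. f (c * x) \<partial>lborel)"
      unfolding U_def using that by (subst integral_complex_mult[of c]) auto
    then show ?thesis using that by (simp add: f_def trunc_density_rotate)
  qed
  show ?thesis
  proof (cases "z = 0")
    case True
    \<comment> \<open>The average 1 / z is meaningless at z = 0; the reflection of x in the origin
      settles this case instead.\<close>
    have "U = (\<integral>x. - f x \<partial>lborel)"
      using rot[of "-1"] True by (simp add: f_def)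
    then have "U = - U" unfolding U_def by simp
    then show ?thesis using True by (simp add: U_def f_def)
  next
    case False
    have w1: "cmod (w t) = 1" for t by (simp add: w_def)
    define g where "g = (\<lambda>t x. indicator {0..1::real} t *\<^sub>R (of_real (trunc_density R x) / (z - w t * x)))"
    have g_int: "integrable lborel (\<lambda>x. of_real (trunc_density R x) / (z - w t * x))" for t
    proof -
      have "integrable lborel (\<lambda>x. f (w t * x))"
        using integrable_trunc_density_kernel[OF assms(1,2) z1] w1[of t]
        by (subst integrable_complex_mult) (auto simp: f_def)
      then show ?thesis using w1 by (simp add: f_def trunc_density_rotate)
    qed
    have nrm: "(\<integral>x. norm (of_real (trunc_density R x) / (z - w t * x)) \<partial>lborel) = (\<integral>x. norm (f x) \<partial>lborel)" for t
    proof -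
      have "(\<integral>x. norm (f x) \<partial>lborel) = (\<integral>x. norm (f (w t * x)) \<partial>lborel)"
        using w1[of t] by (subst integral_complex_mult[of "w t"]) auto
      then show ?thesis using w1 by (simp add: f_def trunc_density_rotate)
    qed
    \<comment> \<open>By \<open>nrm\<close> the area integral of the norm is the same for every
      rotation \<open>w t\<close>, so the outer integrand is a constant on {0..1}.\<close>
    have "integrable (lborel \<Otimes>\<^sub>M lborel) (case_prod g)"
    proof (rule lborel_pair.Fubini_integrable)
      show "case_prod g \<in> borel_measurable (lborel \<Otimes>\<^sub>M lborel)" unfolding g_def by measurable
      have "(\<integral>x. norm (case_prod g (t, x)) \<partial>lborel) = indicator {0..1} t * (\<integral>x. norm (f x) \<partial>lborel)" for t
        using nrm[of t] by (simp add: g_def indicator_def)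
      then show "integrable lborel (\<lambda>t. \<integral>x. norm (case_prod g (t, x)) \<partial>lborel)" by simp
      show "AE t in lborel. integrable lborel (\<lambda>x. case_prod g (t, x))" using g_int by (simp add: g_def)
    qed
    then have "(\<integral>x. \<integral>t. g t x \<partial>lborel \<partial>lborel) = (\<integral>t. \<integral>x. g t x \<partial>lborel \<partial>lborel)"
      by (rule lborel_pair.Fubini_integral)
    also have "(\<integral>t. \<integral>x. g t x \<partial>lborel \<partial>lborel) = (\<integral>t. indicator {0..1::real} t *\<^sub>R U \<partial>lborel)"
      using rot[OF w1] by (simp add: g_def)
    also have "\<dots> = U" by simp
    \<comment> \<open>Only the x with |x| < |z| survive the average. They carry the hyperbolic area
      of \<open>ball 0 (cmod z)\<close>, and R disappears.\<close>
    also have "(\<integral>x. \<integral>t. g t x \<partial>lborel \<partial>lborel) = (\<integral>x. of_real (trunc_density (cmod z) x) * (1 / z) \<partial>lborel)"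
    proof (rule integral_cong_AE)
      show "AE x in lborel. (\<integral>t. g t x \<partial>lborel) = of_real (trunc_density (cmod z) x) * (1 / z)"
        using AE_cmod_neq[of "cmod z"]
      proof eventually_elim
        case (elim x)
        have "(\<integral>t. g t x \<partial>lborel) = (\<integral>t. of_real (trunc_density R x) * (indicator {0..1} t *\<^sub>R (1 / (z - w t * x))) \<partial>lborel)"
          by (simp add: g_def)
        also have "\<dots> = of_real (trunc_density R x) * (if cmod x < cmod z then 1 / z else 0)"
          using integral_circle_inverse[OF elim] by (simp only: w_def integral_mult_right_zero)
        also have "\<dots> = of_real (trunc_density (cmod z) x) * (1 / z)"
          using assms by (auto simp: trunc_density_def indicator_def)
        finally show ?case .
      qed
    qed (simp_all add: g_def)
    also have "\<dots> = of_real (\<integral>x. trunc_density (cmod z) x \<partial>lborel) * (1 / z)" by simp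
    also have "(\<integral>x. trunc_density (cmod z) x \<partial>lborel) = 4 * pi * (cmod z)\<^sup>2 / (1 - (cmod z)\<^sup>2)"
      using integral_hyp_density_ball(2)[of "cmod z"] z1 by (simp add: trunc_density_def)
    also have "of_real \<dots> * (1 / z) = 4 * pi * cnj z / (1 - (cmod z)\<^sup>2)"
    proof -
      have e: "complex_of_real (4 * pi * (cmod z)\<^sup>2 / (1 - (cmod z)\<^sup>2)) = 4 * pi * (z * cnj z) / (1 - (cmod z)\<^sup>2)"
        by (simp only: of_real_divide of_real_mult of_real_diff complex_norm_square of_real_1 of_real_numeral)
      show ?thesis unfolding e using False by simp
    qed
    finally show ?thesis by (simp add: U_def f_def)
  qed
qed

text \<open>The numerator 1 - x cnj \<zeta> is chosen for its value at x = \<zeta>: the coefficient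
  1 - |\<zeta>|^2 cancels the denominator of the potential at \<zeta>.\<close>

lemma kernel_partial_fractions:
  fixes x z \<zeta> :: complex
  assumes "x \<noteq> z" "x \<noteq> \<zeta>" "z \<noteq> \<zeta>"
  shows "(1 - x * cnj \<zeta>) / ((x - \<zeta>) * (z - x))
    = ((1 - z * cnj \<zeta>) * (1 / (z - x)) - (1 - \<zeta> * cnj \<zeta>) * (1 / (\<zeta> - x))) / (z - \<zeta>)"
  using assms by (simp add: divide_simps) (simp add: algebra_simps)

text \<open>After the partial fractions both terms are potentials. Over the common denominator 1 -
  |z|^2 the terms in |z|^2 cnj \<zeta> cancel, and cnj z - cnj \<zeta> remains.\<close>

lemma integral_double_kernel:
  fixes z \<zeta> :: complex
  assumes "0 \<le> R" "R < 1" "cmod z < R" "cmod \<zeta> < R" "z \<noteq> \<zeta>"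
  shows "(\<integral>x. of_real (trunc_density R x) * ((1 - x * cnj \<zeta>) / ((x - \<zeta>) * (z - x))) \<partial>lborel)
    = 4 * pi * (cnj (z - \<zeta>) / ((z - \<zeta>) * (1 - (cmod z)\<^sup>2)))"
proof -
  have z1: "cmod z < 1" "cmod \<zeta> < 1" using assms by auto
  note int = integrable_trunc_density_kernel[OF assms(1,2) z1(1)] integrable_trunc_density_kernel[OF assms(1,2) z1(2)]
  have "(\<integral>x. of_real (trunc_density R x) * ((1 - x * cnj \<zeta>) / ((x - \<zeta>) * (z - x))) \<partial>lborel)
   = (\<integral>x. ((1 - z * cnj \<zeta>) * (of_real (trunc_density R x) / (z - x)) - (1 - \<zeta> * cnj \<zeta>) * (of_real (trunc_density R x) / (\<zeta> - x))) / (z - \<zeta>) \<partial>lborel)"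
  proof (rule integral_cong_AE)
    have "AE x in lborel. x \<noteq> z" "AE x in lborel. x \<noteq> \<zeta>" by (simp_all add: AE_lborel_singleton)
    then show "AE x in lborel. of_real (trunc_density R x) * ((1 - x * cnj \<zeta>) / ((x - \<zeta>) * (z - x)))
      = ((1 - z * cnj \<zeta>) * (of_real (trunc_density R x) / (z - x)) - (1 - \<zeta> * cnj \<zeta>) * (of_real (trunc_density R x) / (\<zeta> - x))) / (z - \<zeta>)"
    proof eventually_elim
      case (elim x)
      then have eq: "(1 - x * cnj \<zeta>) / ((x - \<zeta>) * (z - x))
          = ((1 - z * cnj \<zeta>) * (1 / (z - x)) - (1 - \<zeta> * cnj \<zeta>) * (1 / (\<zeta> - x))) / (z - \<zeta>)"
        using assms(5) by (intro kernel_partial_fractions)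
      show ?case
        unfolding eq by (simp add: algebra_simps diff_divide_distrib)
    qed
  qed measurable
  also have "\<dots> = ((1 - z * cnj \<zeta>) * (4 * pi * cnj z / (1 - (cmod z)\<^sup>2)) - (1 - \<zeta> * cnj \<zeta>) * (4 * pi * cnj \<zeta> / (1 - (cmod \<zeta>)\<^sup>2))) / (z - \<zeta>)"
    by (simp only: integral_divide_zero integral_mult_right_zero hyp_potential[OF assms(1,2,3)] hyp_potential[OF assms(1,2,4)]
        Bochner_Integration.integral_diff[OF integrable_mult_right[OF int(1)] integrable_mult_right[OF int(2)]])
  also have "\<dots> = 4 * pi * (cnj (z - \<zeta>) / ((z - \<zeta>) * (1 - (cmod z)\<^sup>2)))"
  proof -
    have c: "of_real ((cmod \<zeta>)\<^sup>2) = \<zeta> * cnj \<zeta>" "of_real ((cmod z)\<^sup>2) = z * cnj z"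
      by (rule complex_norm_square)+
    have "(cmod \<zeta>)\<^sup>2 < 1" "(cmod z)\<^sup>2 < 1" using z1 by (simp_all add: abs_square_less_1)
    then have "complex_of_real ((cmod \<zeta>)\<^sup>2) \<noteq> 1" "complex_of_real ((cmod z)\<^sup>2) \<noteq> 1"
      by (metis less_irrefl of_real_eq_1_iff)+
    then have n: "1 - \<zeta> * cnj \<zeta> \<noteq> 0" "1 - z * cnj z \<noteq> 0" unfolding c[symmetric] by auto
    show ?thesis
      using n assms(5) unfolding of_real_diff of_real_1 c
      by (simp add: divide_simps) algebra
  qed
  finally show ?thesis .
qed

section \<open>Loops in the hyperbolic disc\<close>

text \<open>The velocity is a separate function \<open>D\<close>, so that it can be Borel measurable
  and bounded on the whole line, with harmless values at the break points \<open>S\<close>. The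
  radius \<open>R\<close> keeps the curve away from the unit circle, which bounds the conformal
  factor along it.\<close>

locale hyp_loop =
  fixes p D :: "real \<Rightarrow> complex" and S :: "real set" and M R :: real
  assumes simple: "simple_path p" and loop: "pathfinish p = pathstart p"
    and image: "path_image p \<subseteq> ball 0 R" and R: "0 < R" "R < 1"
    and finite_S: "finite S"
    and deriv: "\<And>t. t \<in> {0<..<1} - S \<Longrightarrow> (p has_vector_derivative D t) (at t)"
    and cont_D: "continuous_on ({0<..<1} - S) D"
    and D_measurable [measurable]: "D \<in> borel_measurable borel"
    and D_bound: "\<And>t. cmod (D t) \<le> M"
    and D_zero: "\<And>t. t \<notin> {0..1} \<Longrightarrow> D t = 0"
begin

text \<open>The extension of \<open>p\<close> to the line is only a convenience: \<open>D\<close> vanishes off \<open>{0..1}\<close>, so integrals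
  over \<open>lborel\<close> against \<open>D\<close> are contour integrals along \<open>p\<close>.\<close>

definition G :: "real \<Rightarrow> complex" where "G t = p (max 0 (min 1 t))"

definition I :: "complex set" where "I = inside (path_image p)"

definition area :: real where "area = (\<integral>x. hyp_density x * indicator I x \<partial>lborel)"

definition len :: real where "len = (\<integral>t. 2 * cmod (D t) / (1 - (cmod (G t))\<^sup>2) \<partial>lborel)"

lemma G_eq: "t \<in> {0..1} \<Longrightarrow> G t = p t"
  by (simp add: G_def)

lemma continuous_G: "continuous_on UNIV G"
proof -
  have "continuous_on {0..1} p" using simple simple_path_imp_path path_def by blast
  moreover have "continuous_on UNIV (\<lambda>t::real. max 0 (min 1 t))" by (intro continuous_intros)
  ultimately show ?thesis unfolding G_def
    by (rule continuous_on_compose2) auto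
qed

lemma G_measurable [measurable]: "G \<in> borel_measurable borel"
  by (rule borel_measurable_continuous_onI[OF continuous_G])

lemma G_image: "G t \<in> path_image p"
  by (auto simp: G_def path_image_def)

lemma G_less: "cmod (G t) < R"
  using G_image image by fastforce

lemma G_less1: "cmod (G t) < 1"
  using G_less[of t] R by simp

lemma G_sq: "0 < 1 - (cmod (G t))\<^sup>2"
  using G_less1[of t] by (simp add: abs_square_less_1)

lemma G_sq_bound: "1 / (1 - (cmod (G t))\<^sup>2) \<le> 1 / (1 - R\<^sup>2)"
proof -
  have "(cmod (G t))\<^sup>2 \<le> R\<^sup>2" "R\<^sup>2 < 1" using G_less[of t] R by (auto intro!: power_mono simp: abs_square_less_1)
  then show ?thesis by (intro divide_left_mono mult_pos_pos) auto
qed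

lemma M_nonneg: "0 \<le> M"
  using order_trans[OF norm_ge_zero D_bound[of 0]] .

lemma D_le: "cmod (D t) \<le> M * indicator {0..1} t"
  using D_bound[of t] D_zero[of t] by (auto simp: indicator_def)

lemma valid_path: "valid_path p"
proof -
  have "continuous_on {0..1} p" using simple simple_path_imp_path path_def by blast
  moreover have "p C1_differentiable_on ({0..1} - (S \<union> {0,1}))"
  proof -
    have eq: "{0..1} - (S \<union> {0,1}) = {0<..<1} - S" by auto
    show ?thesis
      unfolding eq C1_differentiable_on_def using deriv cont_D by (intro exI[of _ D] conjI ballI) assumption+
  qed
  ultimately show ?thesis
    unfolding valid_path_def piecewise_C1_differentiable_on_def
    using finite_S by (intro conjI exI[of _ "S \<union> {0,1}"]) simp_all
qed

text \<open>A differentiable image of a set of lower dimension is negligible, and the break points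
  add finitely many points. The Cauchy integral along the curve is evaluated only at points off the
  curve, so the area integrals have to ignore the curve itself.\<close>

lemma null_path_image: "path_image p \<in> null_sets lborel"
proof -
  have "p differentiable_on ({0<..<1} - S)"
    unfolding differentiable_on_def
    by (rule ballI, rule differentiable_at_withinI, rule differentiableI_vector, erule deriv)
  then have "negligible (p ` ({0<..<1} - S))"
    by (intro negligible_differentiable_image_lowdim) auto
  moreover have "negligible (p ` (S \<union> {0,1}))" using finite_S by (intro negligible_finite) auto
  moreover have "path_image p \<subseteq> p ` ({0<..<1} - S) \<union> p ` (S \<union> {0,1})"
    by (auto simp: path_image_def less_le)
  ultimately have "negligible (path_image p)"
    by (rule negligible_subset[OF negligible_Un])
  moreover have "closed (path_image p)"
    using simple by (simp add: closed_path_image simple_path_imp_path)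
  ultimately show ?thesis by (simp add: negligible_iff_null_sets null_sets_completion_iff)
qed

lemma AE_not_path_image: "AE x in lborel. x \<notin> path_image p"
  using null_path_image by (rule AE_not_in)

lemma I_subset: "I \<subseteq> ball 0 R"
  using outside_subset_convex[OF convex_ball image] by (auto simp: I_def inside_outside)

lemma I_measurable [measurable]: "I \<in> sets borel"
proof -
  have "open I" unfolding I_def using simple
    by (intro open_inside closed_path_image simple_path_imp_path)
  then show ?thesis by simp
qed

lemma integrable_bounded_on_unit:
  fixes f :: "real \<Rightarrow> complex"
  assumes [measurable]: "f \<in> borel_measurable borel" and "\<And>t. cmod (f t) \<le> B * indicator {0..1} t"
  shows "integrable lborel f"
proof (rule Bochner_Integration.integrable_bound)
  show "integrable lborel (\<lambda>t. B * indicator {0..1::real} t)" by simp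
  show "AE t in lborel. norm (f t) \<le> norm (B * indicator {0..1::real} t)"
    using assms(2) by (intro AE_I2) (simp add: order_trans[OF _ abs_ge_self])
qed simp

lemma winding_integral:
  assumes x: "x \<notin> path_image p"
  shows "(\<integral>t. D t / (G t - x) \<partial>lborel) = 2 * pi * \<i> * winding_number p x"
    and "integrable lborel (\<lambda>t. D t / (G t - x))"
proof -
  obtain d where d: "d > 0" "\<And>y. y \<in> path_image p \<Longrightarrow> d \<le> dist x y"
    using separate_point_closed[of "path_image p" x] x simple
    by (auto simp: closed_path_image simple_path_imp_path)
  have "cmod (D t / (G t - x)) \<le> (M / d) * indicator {0..1} t" for t
  proof -
    have "cmod (D t) / cmod (G t - x) \<le> (M * indicator {0..1} t) / d"
      using d(2)[OF G_image[of t]] d(1) D_le[of t] M_nonneg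
      by (intro frac_le) (auto simp: dist_norm norm_minus_commute)
    then show ?thesis by (simp add: norm_divide)
  qed
  then show int: "integrable lborel (\<lambda>t. D t / (G t - x))"
    by (intro integrable_bounded_on_unit[where B = "M / d"]) auto
  have "((\<lambda>w. 1 / (w - x)) has_contour_integral contour_integral p (\<lambda>w. 1 / (w - x))) p"
    using contour_integrable_inversediff[OF valid_path x] by (rule has_contour_integral_integral)
  then have "((\<lambda>t. 1 / (p t - x) * vector_derivative p (at t)) has_integral contour_integral p (\<lambda>w. 1 / (w - x))) {0..1}"
    by (simp add: has_contour_integral)
  then have "((\<lambda>t. D t / (G t - x)) has_integral contour_integral p (\<lambda>w. 1 / (w - x))) {0..1}"
  proof (rule has_integral_spike_finite[rotated 2])
    show "finite (S \<union> {0,1})" using finite_S by simp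
    fix t assume "t \<in> {0..1} - (S \<union> {0,1})"
    then have t: "t \<in> {0<..<1} - S" by auto
    show "D t / (G t - x) = 1 / (p t - x) * vector_derivative p (at t)"
      using vector_derivative_at[OF deriv[OF t]] t by (simp add: G_eq)
  qed
  then have "((\<lambda>t. D t / (G t - x)) has_integral contour_integral p (\<lambda>w. 1 / (w - x))) UNIV"
    by (rule has_integral_on_superset) (auto simp: D_zero)
  then have "(\<integral>t. D t / (G t - x) \<partial>lborel) = contour_integral p (\<lambda>w. 1 / (w - x))"
    using has_integral_integral_lborel[OF int] has_integral_unique by blast
  then show "(\<integral>t. D t / (G t - x) \<partial>lborel) = 2 * pi * \<i> * winding_number p x"
    using winding_number_valid_path[OF valid_path x] by simp
qed

text \<open>The orientation is kept as one number \<open>e\<close> with \<open>e * e = 1\<close>,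
  because it occurs once in each of the two loop integrals and drops out of the product.\<close>

lemma winding_integral_sign:
  obtains e :: complex where "e * e = 1"
    "\<And>x. x \<notin> path_image p \<Longrightarrow> (\<integral>t. D t / (G t - x) \<partial>lborel) = 2 * pi * \<i> * e * indicator I x"
proof -
  have out: "winding_number p x = 0" if "x \<notin> path_image p" "x \<notin> I" for x
  proof (rule winding_number_zero_in_outside)
    show "path p" using simple simple_path_imp_path by blast
    show "x \<in> outside (path_image p)" using that inside_Un_outside unfolding I_def by blast
  qed (rule loop)
  obtain e :: complex where "e * e = 1" "\<And>x. x \<in> I \<Longrightarrow> winding_number p x = e"
  proof (rule simple_closed_path_winding_number_inside[OF simple])
    assume "\<And>x. x \<in> inside (path_image p) \<Longrightarrow> winding_number p x = 1"
    then show thesis using that[of 1] by (simp add: I_def)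
  next
    assume "\<And>x. x \<in> inside (path_image p) \<Longrightarrow> winding_number p x = -1"
    then show thesis using that[of "-1"] by (simp add: I_def)
  qed
  then show thesis using that[of e] out winding_integral(1) by (auto simp: indicator_def)
qed

end

section \<open>Separating two poles\<close>

lemma powr_minus_three_halves: "0 < (a::real) \<Longrightarrow> a powr (-3/2) = 1 / (a * sqrt a)"
proof -
  assume a: "0 < a"
  have "a powr (3/2) = a powr (1 + 1/2)" by simp
  also have "\<dots> = a * sqrt a" using a by (subst powr_add) (simp add: powr_half_sqrt)
  finally show ?thesis using powr_minus_divide[of a "3/2"] by simp
qed

text \<open>The larger of a and b is at least r / 2. If a \<le> b, half a power of b is traded for
  half a power of r: sqrt a sqrt r \<le> sqrt b sqrt (2 b) \<le> 2 b. In the application a and b are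
  the distances from x to two poles, and r bounds the distance of the poles from below. If a or b is
  0, the left side is 0 by convention.\<close>

lemma inverse_mult_le_powr:
  fixes a b r :: real
  assumes "0 \<le> a" "0 \<le> b" "0 < r" "r \<le> a + b"
  shows "1 / (a * b) \<le> r powr (-1/2) * (2 * (a powr (-3/2) + b powr (-3/2)))"
proof -
  have *: "1 / (a * b) \<le> r powr (-1/2) * (2 * a powr (-3/2))"
    if "0 < a" "a \<le> b" "0 < r" "r \<le> a + b" for a b :: real
  proof -
    have "sqrt a * sqrt r \<le> sqrt b * sqrt (2 * b)"
      using that by (intro mult_mono real_sqrt_le_mono) auto
    also have "\<dots> = sqrt 2 * b" using that by (simp add: real_sqrt_mult)
    also have "sqrt 2 \<le> (2::real)" by (simp add: real_le_lsqrt)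
    finally have le: "sqrt a * sqrt r \<le> 2 * b" using that by simp
    have "1 / (a * b) \<le> 2 / (a * sqrt a * sqrt r)"
      using that le by (simp add: field_simps)
    also have "\<dots> = r powr (-1/2) * (2 * a powr (-3/2))"
      using that powr_minus_divide[of r "1/2"] powr_minus_three_halves[of a] by (simp add: powr_half_sqrt)
    finally show ?thesis .
  qed
  show ?thesis
  proof (cases "a = 0 \<or> b = 0")
    case True
    then show ?thesis by auto
  next
    case False
    then have pos: "0 < a" "0 < b" using assms by auto
    have nn: "0 \<le> r powr (-1/2) * (2 * a powr (-3/2))" "0 \<le> r powr (-1/2) * (2 * b powr (-3/2))" by simp_all
    show ?thesis
    proof (cases "a \<le> b")
      case True
      from *[OF pos(1) True assms(3,4)] show ?thesis
        unfolding distrib_left[of 2] distrib_left[of "r powr (-1/2)"] using nn(2) by linarith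
    next
      case False
      then have "1 / (b * a) \<le> r powr (-1/2) * (2 * b powr (-3/2))" using pos assms by (intro *) auto
      then show ?thesis
        unfolding distrib_left[of 2] distrib_left[of "r powr (-1/2)"] mult.commute[of a b] using nn(1) by linarith
    qed
  qed
qed

lemma integrable_abs_diff_powr:
  "integrable lborel (\<lambda>s. \<bar>s - t\<bar> powr (-1/2) * indicator {0..1::real} s)" if "0 \<le> t" "t \<le> 1"
proof -
  define f where "f = (\<lambda>u::real. u powr (-1/2) * indicator {0..1} u)"
  have [measurable]: "f \<in> borel_measurable borel" unfolding f_def by measurable
  have "integrable lborel f"
  proof (rule integrableI_nonneg)
    have "(\<integral>\<^sup>+u. ennreal (f u) \<partial>lborel) = (\<integral>\<^sup>+u. ennreal (u powr (-1/2)) * indicator {0..1} u \<partial>lborel)"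
      by (intro nn_integral_cong) (auto simp: f_def indicator_def)
    also have "\<dots> = ennreal (1 powr (-1/2+1) / (-1/2+1))"
      by (rule nn_integral_has_integral_lebesgue'[OF _ has_integral_powr_from_0]) auto
    finally show "(\<integral>\<^sup>+u. ennreal (f u) \<partial>lborel) < \<infinity>" by simp
  qed (auto simp: f_def)
  \<comment> \<open>One substitution for each side of t, written in the affine form of
    \<open>lborel_integrable_real_affine_iff\<close>.\<close>
  then have "integrable lborel (\<lambda>s. f (-t + 1 * s))" "integrable lborel (\<lambda>s. f (t + (-1) * s))"
    by (simp_all only: lborel_integrable_real_affine_iff)
  then have "integrable lborel (\<lambda>s. f (-t + 1 * s) + f (t + (-1) * s))" by (rule Bochner_Integration.integrable_add)
  then show ?thesis
  proof (rule Bochner_Integration.integrable_bound)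
    show "AE s in lborel. norm (\<bar>s - t\<bar> powr (-1/2) * indicator {0..1} s) \<le> norm (f (-t + 1 * s) + f (t + (-1) * s))"
    proof (rule AE_I2)
      fix s
      have nn: "0 \<le> f u" for u by (simp add: f_def)
      have "\<bar>s - t\<bar> powr (-1/2) * indicator {0..1} s \<le> f (s - t) + f (t - s)"
      proof (cases "s \<in> {0..1}")
        case True
        then have "\<bar>s - t\<bar> powr (-1/2) = (if t \<le> s then f (s - t) else f (t - s))"
          using that by (simp add: f_def)
        then show ?thesis using True nn[of "s - t"] nn[of "t - s"] by (simp split: if_splits)
      qed (simp add: nn)
      then show "norm (\<bar>s - t\<bar> powr (-1/2) * indicator {0..1} s) \<le> norm (f (-t + 1 * s) + f (t + (-1) * s))"
        by (simp add: nn)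
    qed
  qed simp
qed

context hyp_loop
begin

abbreviation k :: "complex \<Rightarrow> real" where "k \<equiv> trunc_density R"

lemma hyp_density_I: "hyp_density x * indicator I x = k x * indicator I x"
proof (cases "x \<in> I")
  case True
  then have "x \<in> ball 0 R" using I_subset by blast
  then show ?thesis by (simp add: trunc_density_def)
qed simp

lemma area_eq: "area = (\<integral>x. k x * indicator I x \<partial>lborel)"
  by (simp add: area_def hyp_density_I)

text \<open>The exchange for kernels with a single pole in x, located at \<open>G t\<close>. The
  area integral of the pole is at most \<open>C\<close> for all t, so the outer integrand is
  dominated by a constant on {0..1}.\<close>

lemma fubini_kernel:
  fixes q :: "real \<Rightarrow> complex \<Rightarrow> complex"
  assumes [measurable]: "case_prod q \<in> borel_measurable (borel \<Otimes>\<^sub>M borel)" and "0 \<le> B"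
    and q: "\<And>t x. cmod (q t x) \<le> B * indicator {0..1} t * (k x / cmod (x - G t))"
  shows "(\<integral>t. \<integral>x. q t x \<partial>lborel \<partial>lborel) = (\<integral>x. \<integral>t. q t x \<partial>lborel \<partial>lborel)"
proof -
  define C where "C = (\<integral>x. k x \<partial>lborel) + 4 / (1 - R\<^sup>2)\<^sup>2 * (8 * pi * sqrt 2)"
  have k_int: "integrable lborel (\<lambda>x. k x / cmod (x - G t))" "(\<integral>x. k x / cmod (x - G t) \<partial>lborel) \<le> C" for t
    using integrable_trunc_density_div[of R "G t"] R G_less1[of t] by (auto simp: C_def)
  have kB: "integrable lborel (\<lambda>x. B * indicator {0..1} t * (k x / cmod (x - G t)))" for t
    using k_int(1) by (rule integrable_mult_right)
  have q_int: "integrable lborel (q t)" for t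
    by (rule Bochner_Integration.integrable_bound[OF kB[of t]])
       (simp_all only: real_norm_def order_trans[OF q abs_ge_self] AE_I2, measurable)
  have "integrable (lborel \<Otimes>\<^sub>M lborel) (case_prod q)"
  proof (rule lborel_pair.Fubini_integrable)
    have "(\<integral>x. norm (q t x) \<partial>lborel) \<le> B * C * indicator {0..1} t" for t
    proof -
      have "(\<integral>x. norm (q t x) \<partial>lborel) \<le> (\<integral>x. B * indicator {0..1} t * (k x / cmod (x - G t)) \<partial>lborel)"
        by (rule integral_mono[OF integrable_norm[OF q_int] kB q])
      also have "\<dots> = B * indicator {0..1} t * (\<integral>x. k x / cmod (x - G t) \<partial>lborel)"
        by (rule integral_mult_right_zero)
      also have "\<dots> \<le> B * indicator {0..1} t * C"
        using k_int(2) assms(2) by (intro mult_left_mono) auto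
      finally show ?thesis by (simp add: mult_ac)
    qed
    then have b: "norm (\<integral>x. norm (q t x) \<partial>lborel) \<le> norm (B * C * indicator {0..1} t)" for t
      by (subst real_norm_def, subst abs_of_nonneg) (auto intro!: order_trans[OF _ abs_ge_self] integral_nonneg_AE simp del: abs_mult)
    show "integrable lborel (\<lambda>t. \<integral>x. norm (case_prod q (t, x)) \<partial>lborel)"
      by (rule Bochner_Integration.integrable_bound[where f = "\<lambda>t. B * C * indicator {0..1::real} t"])
         (use b in auto)
  qed (use q_int in auto)
  then show ?thesis by (intro lborel_pair.Fubini_integral[symmetric])
qed

text \<open>Near t the derivative dominates its remainder. Away from t, compactness and injectivity
  keep \<open>p s\<close> at a distance m from \<open>p t\<close>, and |s - t| \<le> 1 turns m into
  a linear bound.\<close>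

lemma chord_lower_bound:
  assumes t: "t \<in> {0<..<1} - S" and D: "D t \<noteq> 0"
  obtains c where "0 < c" "\<And>s. s \<in> {0..1} \<Longrightarrow> c * \<bar>s - t\<bar> \<le> cmod (G s - G t)"
proof -
  have "(p has_derivative (\<lambda>h. h *\<^sub>R D t)) (at t)"
    using deriv[OF t] by (simp add: has_vector_derivative_def)
  then have "\<forall>e>0. \<exists>d>0. \<forall>s. norm (s - t) < d \<longrightarrow> norm (p s - p t - (s - t) *\<^sub>R D t) \<le> e * norm (s - t)"
    unfolding has_derivative_at_alt by blast
  \<comment> \<open>With half the speed as tolerance, the other half remains as a lower
    bound.\<close>
  moreover have "0 < cmod (D t) / 2" using D by simp
  ultimately obtain d where d: "d > 0"
    "\<And>s. norm (s - t) < d \<Longrightarrow> norm (p s - p t - (s - t) *\<^sub>R D t) \<le> cmod (D t) / 2 * norm (s - t)"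
    by blast
  define K where "K = {0..1} - ball t d"
  have "\<exists>m>0. \<forall>s\<in>K. m \<le> cmod (p s - p t)"
  proof -
    have "compact K" unfolding K_def by (simp add: compact_diff)
    moreover have "continuous_on {0..1} p" using simple simple_path_imp_path path_def by blast
    then have "continuous_on K p" by (rule continuous_on_subset) (auto simp: K_def)
    ultimately have "closed (p ` K)" by (intro compact_imp_closed compact_continuous_image)
    \<comment> \<open>The only double point of the loop has the parameters 0 and 1, and t is
      strictly between them.\<close>
    moreover have "p t \<notin> p ` K"
    proof
      assume "p t \<in> p ` K"
      then obtain s where "s \<in> K" "p t = p s" by auto
      then have "s \<in> {0..1}" "s \<noteq> t" using d(1) by (auto simp: K_def)
      moreover have "\<forall>x\<in>{0..1}. \<forall>y\<in>{0..1}. p x = p y \<longrightarrow> x = y \<or> x = 0 \<and> y = 1 \<or> x = 1 \<and> y = 0"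
        using simple by (simp add: simple_path_def loop_free_def)
      moreover have "t \<in> {0..1}" "t \<noteq> 0" "t \<noteq> 1" using t by auto
      ultimately show False using \<open>p t = p s\<close> by blast
    qed
    ultimately obtain m where "m > 0" "\<forall>y\<in>p ` K. m \<le> dist (p t) y"
      using separate_point_closed[of "p ` K" "p t"] by metis
    then show ?thesis by (intro exI[of _ m]) (auto simp: dist_norm norm_minus_commute)
  qed
  then obtain m where m: "m > 0" "\<And>s. s \<in> K \<Longrightarrow> m \<le> cmod (p s - p t)" by auto
  define c where "c = min m (cmod (D t) / 2)"
  show thesis
  proof
    show "0 < c" using m D by (simp add: c_def)
    fix s :: real assume s: "s \<in> {0..1}"
    have "c * \<bar>s - t\<bar> \<le> cmod (p s - p t)"
    proof (cases "\<bar>s - t\<bar> < d")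
      case True
      have "cmod ((s - t) *\<^sub>R D t) \<le> cmod (p s - p t) + cmod (p s - p t - (s - t) *\<^sub>R D t)"
        using norm_triangle_ineq4[of "p s - p t" "p s - p t - (s - t) *\<^sub>R D t"] by simp
      then have "\<bar>s - t\<bar> * cmod (D t) \<le> cmod (p s - p t) + cmod (D t) / 2 * \<bar>s - t\<bar>"
        using d(2)[of s] True by simp
      moreover have "c * \<bar>s - t\<bar> \<le> cmod (D t) / 2 * \<bar>s - t\<bar>" by (intro mult_right_mono) (auto simp: c_def)
      ultimately show ?thesis by (simp add: mult.commute)
    next
      case False
      then have "s \<in> K" using s by (auto simp: K_def dist_real_def abs_minus_commute)
      then have "m \<le> cmod (p s - p t)" by (rule m)
      moreover have "c * \<bar>s - t\<bar> \<le> m * 1" using s t m by (intro mult_mono) (auto simp: c_def)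
      ultimately show ?thesis by simp
    qed
    then show "c * \<bar>s - t\<bar> \<le> cmod (G s - G t)" using s t by (simp add: G_eq)
  qed
qed

lemma k_kernel_le:
  assumes "cmod \<zeta> < 1"
  shows "k x * cmod (1 - x * cnj \<zeta>) \<le> 2 * k x"
proof (cases "cmod x < R")
  case True
  have "cmod (1 - x * cnj \<zeta>) \<le> 1 + cmod x * cmod \<zeta>"
    using norm_triangle_ineq4[of 1 "x * cnj \<zeta>"] by (simp add: norm_mult)
  also have "cmod x * cmod \<zeta> \<le> 1 * 1" using True R assms by (intro mult_mono) auto
  finally show ?thesis using mult_left_mono[of "cmod (1 - x * cnj \<zeta>)" 2 "k x"] trunc_density_nonneg[of R x] by (simp add: mult.commute)
qed (simp add: trunc_density_def)

end

section \<open>The isoperimetric inequality as a double loop integral\<close>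

lemma measurable_cnj [measurable]: "cnj \<in> borel_measurable borel"
  by (intro borel_measurable_continuous_onI continuous_intros)

context hyp_loop
begin

text \<open>The inner kernel, normalized as in \<open>integral_double_kernel\<close> but without 4
  pi. The conformal factor at \<zeta> belongs to the outer integral.\<close>

definition kern :: "complex \<Rightarrow> complex \<Rightarrow> complex" where
  "kern z \<zeta> = cnj (z - \<zeta>) / ((z - \<zeta>) * (1 - (cmod z)\<^sup>2))"

lemma kern_measurable [measurable]: "case_prod kern \<in> borel_measurable (borel \<Otimes>\<^sub>M borel)"
  unfolding kern_def by measurable

lemma AE_regular: "AE t in lborel. t \<notin> S \<union> {0,1}"
  using finite_S by (intro AE_not_in finite_imp_null_set_lborel) simp

text \<open>The area integral of \<open>1 / (|x - \<zeta>| |x - z|)\<close> is only bounded by a multiple of \<open>|z - \<zeta>|\<close> to the power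
  \<open>-1/2\<close>. This is integrable in \<open>s\<close> for \<open>\<zeta> = G t\<close> fixed because \<open>|G s - G t| \<ge> c |s - t|\<close>, which needs
  \<open>D t \<noteq> 0\<close>; the other \<open>t\<close> do not contribute to the outer integral.\<close>

lemma inner_loop_fubini:
  assumes t: "t \<in> {0<..<1} - S" and D: "D t \<noteq> 0"
  shows "(\<integral>s. \<integral>x. D s * (k x * ((1 - x * cnj (G t)) / ((x - G t) * (G s - x)))) \<partial>lborel \<partial>lborel)
       = (\<integral>x. \<integral>s. D s * (k x * ((1 - x * cnj (G t)) / ((x - G t) * (G s - x)))) \<partial>lborel \<partial>lborel)"
proof -
  define \<zeta> where "\<zeta> = G t"
  define q where "q = (\<lambda>s x. D s * (k x * ((1 - x * cnj \<zeta>) / ((x - \<zeta>) * (G s - x)))))"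
  have [measurable]: "case_prod q \<in> borel_measurable (lborel \<Otimes>\<^sub>M lborel)"
    unfolding q_def by measurable
  obtain c where c: "0 < c" "\<And>s. s \<in> {0..1} \<Longrightarrow> c * \<bar>s - t\<bar> \<le> cmod (G s - \<zeta>)"
    using chord_lower_bound[OF t D] unfolding \<zeta>_def by blast
  define P where "P = (\<lambda>z x. k x * cmod (x - z) powr (-3/2))"
  define C where "C = 4 / (1 - R\<^sup>2)\<^sup>2 * (8 * pi * sqrt 2)"
  \<comment> \<open>The 4 is 2 * 2: one factor from \<open>k_kernel_le\<close>, one from
    \<open>inverse_mult_le_powr\<close> with r = c |s - t|. At s = t that r is 0, hence the
    restriction to s \<noteq> t below.\<close>
  define H where "H = (\<lambda>s. 4 * M * c powr (-1/2) * (\<bar>s - t\<bar> powr (-1/2) * indicator {0..1::real} s))"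
  have H0: "0 \<le> H s" for s using M_nonneg by (simp add: H_def)
  have P_int: "integrable lborel (P z)" "(\<integral>x. P z x \<partial>lborel) \<le> C" if "cmod z < 1" for z
    using integrable_trunc_density_powr[of R z] integral_trunc_density_powr[of R z] R that by (auto simp: P_def C_def)
  have P0: "0 \<le> P z x" for z x by (simp add: P_def trunc_density_nonneg)
  have \<zeta>1: "cmod \<zeta> < 1" by (simp add: \<zeta>_def G_less1)
  have q_le: "cmod (q s x) \<le> H s * (P \<zeta> x + P (G s) x)" if "s \<noteq> t" for s x
  proof (cases "s \<in> {0..1}")
    case False
    then show ?thesis by (simp add: q_def H_def D_zero)
  next
    case True
    define r where "r = c * \<bar>s - t\<bar>"
    have r0: "0 < r" using c(1) that by (simp add: r_def)
    have "r \<le> cmod (x - \<zeta>) + cmod (x - G s)"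
      using c(2)[OF True] norm_triangle_ineq4[of "x - \<zeta>" "x - G s"] by (simp add: r_def)
    then have i: "1 / (cmod (x - \<zeta>) * cmod (x - G s)) \<le> r powr (-1/2) * (2 * (cmod (x - \<zeta>) powr (-3/2) + cmod (x - G s) powr (-3/2)))"
      using r0 by (intro inverse_mult_le_powr) auto
    have rp: "r powr (-1/2) = c powr (-1/2) * \<bar>s - t\<bar> powr (-1/2)"
      using c(1) by (simp add: r_def powr_mult)
    have "cmod (q s x) = cmod (D s) * (k x * cmod (1 - x * cnj \<zeta>)) * (1 / (cmod (x - \<zeta>) * cmod (x - G s)))"
      by (simp add: q_def norm_mult norm_divide trunc_density_nonneg norm_minus_commute)
    also have "\<dots> \<le> M * (2 * k x) * (r powr (-1/2) * (2 * (cmod (x - \<zeta>) powr (-3/2) + cmod (x - G s) powr (-3/2))))"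
      using M_nonneg trunc_density_nonneg[of R x]
      by (intro mult_mono[OF mult_mono[OF D_bound k_kernel_le[OF \<zeta>1]] i]) auto
    also have "\<dots> = H s * (P \<zeta> x + P (G s) x)"
      unfolding rp using True by (simp add: H_def P_def algebra_simps)
    finally show ?thesis .
  qed
  have PP_int: "integrable lborel (\<lambda>x. H s * (P \<zeta> x + P (G s) x))" for s
    using P_int(1)[OF \<zeta>1] P_int(1)[OF G_less1] by (intro integrable_mult_right Bochner_Integration.integrable_add)
  have q_int: "integrable lborel (q s)" if "s \<noteq> t" for s
  proof (rule Bochner_Integration.integrable_bound[OF PP_int[of s]])
    show "AE x in lborel. norm (q s x) \<le> norm (H s * (P \<zeta> x + P (G s) x))"
      by (rule AE_I2) (simp only: real_norm_def order_trans[OF q_le[OF that] abs_ge_self])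
  qed (simp add: q_def)
  have AE_t: "AE s in lborel. s \<noteq> t" by (rule AE_lborel_singleton)
  have "integrable (lborel \<Otimes>\<^sub>M lborel) (case_prod q)"
  proof (rule lborel_pair.Fubini_integrable)
    \<comment> \<open>Each of the two poles contributes at most \<open>C\<close>, wherever it lies;
      only the factor \<open>H s\<close> depends on their distance.\<close>
    have le: "(\<integral>x. norm (q s x) \<partial>lborel) \<le> 2 * C * H s" if "s \<noteq> t" for s
    proof -
      have "(\<integral>x. norm (q s x) \<partial>lborel) \<le> (\<integral>x. H s * (P \<zeta> x + P (G s) x) \<partial>lborel)"
        by (rule integral_mono[OF integrable_norm[OF q_int[OF that]] PP_int q_le[OF that]])
      also have "\<dots> = H s * ((\<integral>x. P \<zeta> x \<partial>lborel) + (\<integral>x. P (G s) x \<partial>lborel))"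
        using P_int(1)[OF \<zeta>1] P_int(1)[OF G_less1] by simp
      also have "\<dots> \<le> H s * (C + C)"
        using P_int(2)[OF \<zeta>1] P_int(2)[OF G_less1[of s]] H0 by (intro mult_left_mono add_mono) auto
      finally show ?thesis by (simp add: mult_ac)
    qed
    show "integrable lborel (\<lambda>s. \<integral>x. norm (case_prod q (s, x)) \<partial>lborel)"
    proof (rule Bochner_Integration.integrable_bound)
      show "integrable lborel (\<lambda>s. 2 * C * H s)"
        unfolding H_def using t by (intro integrable_mult_right integrable_abs_diff_powr) auto
      show "AE s in lborel. norm (\<integral>x. norm (case_prod q (s, x)) \<partial>lborel) \<le> norm (2 * C * H s)"
        using AE_t
      proof eventually_elim
        case (elim s)
        have "0 \<le> (\<integral>x. norm (q s x) \<partial>lborel)" by (intro integral_nonneg_AE AE_I2) simp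
        then show ?case using le[OF elim] by simp
      qed
    qed measurable
    show "AE s in lborel. integrable lborel (\<lambda>x. case_prod q (s, x))"
      using AE_t by eventually_elim (simp add: q_int)
  qed measurable
  then show ?thesis
    unfolding q_def \<zeta>_def by (intro lborel_pair.Fubini_integral[symmetric])
qed

text \<open>The area integral of \<open>integral_double_kernel\<close> replaces 4 pi
  \<open>kern\<close>; after the exchange the integral over s is a Cauchy integral, and 2 pi i e /
  (4 pi) = i e / 2. The sign \<open>e\<close> is a parameter, so that this lemma and the next can be
  used with the same one.\<close>

lemma inner_loop_integral:
  assumes e: "\<And>x. x \<notin> path_image p \<Longrightarrow> (\<integral>t. D t / (G t - x) \<partial>lborel) = 2 * pi * \<i> * e * indicator I x"
    and t: "t \<in> {0<..<1} - S" and D: "D t \<noteq> 0"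
  shows "(\<integral>s. D s * kern (G s) (G t) \<partial>lborel)
     = \<i> * e / 2 * (\<integral>x. k x * indicator I x * ((1 - x * cnj (G t)) / (x - G t)) \<partial>lborel)"
proof -
  define \<zeta> where "\<zeta> = G t"
  obtain c where c: "0 < c" "\<And>s. s \<in> {0..1} \<Longrightarrow> c * \<bar>s - t\<bar> \<le> cmod (G s - \<zeta>)"
    using chord_lower_bound[OF t D] unfolding \<zeta>_def by blast
  have "4 * pi * (\<integral>s. D s * kern (G s) \<zeta> \<partial>lborel) = (\<integral>s. 4 * pi * (D s * kern (G s) \<zeta>) \<partial>lborel)"
    by (rule integral_mult_right_zero[symmetric])
  also have "\<dots> = (\<integral>s. \<integral>x. D s * (k x * ((1 - x * cnj \<zeta>) / ((x - \<zeta>) * (G s - x)))) \<partial>lborel \<partial>lborel)"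
  proof (rule integral_cong_AE)
    have "AE s in lborel. s \<noteq> t" by (rule AE_lborel_singleton)
    then show "AE s in lborel. 4 * pi * (D s * kern (G s) \<zeta>) = (\<integral>x. D s * (k x * ((1 - x * cnj \<zeta>) / ((x - \<zeta>) * (G s - x)))) \<partial>lborel)"
    proof eventually_elim
      case (elim s)
      show ?case
      proof (cases "s \<in> {0..1}")
        case True
        \<comment> \<open>\<open>integral_double_kernel\<close> needs two distinct poles; the chord
          bound provides them.\<close>
        have "0 < c * \<bar>s - t\<bar>" using c(1) elim by simp
        with c(2)[OF True] have "0 < cmod (G s - \<zeta>)" by linarith
        then have ne: "G s \<noteq> \<zeta>" by auto
        have "(\<integral>x. D s * (k x * ((1 - x * cnj \<zeta>) / ((x - \<zeta>) * (G s - x)))) \<partial>lborel)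
           = D s * (4 * pi * kern (G s) \<zeta>)"
        proof -
          have "(\<integral>x. k x * ((1 - x * cnj \<zeta>) / ((x - \<zeta>) * (G s - x))) \<partial>lborel) = 4 * pi * kern (G s) \<zeta>"
            unfolding kern_def using R G_less[of s] G_less[of t] ne
            by (intro integral_double_kernel) (auto simp: \<zeta>_def)
          then show ?thesis by (simp only: integral_mult_right_zero)
        qed
        then show ?thesis by (simp add: mult_ac)
      qed (simp add: D_zero)
    qed
  qed measurable
  also have "\<dots> = (\<integral>x. \<integral>s. D s * (k x * ((1 - x * cnj \<zeta>) / ((x - \<zeta>) * (G s - x)))) \<partial>lborel \<partial>lborel)"
    unfolding \<zeta>_def by (rule inner_loop_fubini[OF t D])
  also have "\<dots> = (\<integral>x. 2 * pi * \<i> * e * (k x * indicator I x * ((1 - x * cnj \<zeta>) / (x - \<zeta>))) \<partial>lborel)"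
  proof (rule integral_cong_AE)
    show "AE x in lborel. (\<integral>s. D s * (k x * ((1 - x * cnj \<zeta>) / ((x - \<zeta>) * (G s - x)))) \<partial>lborel)
       = 2 * pi * \<i> * e * (k x * indicator I x * ((1 - x * cnj \<zeta>) / (x - \<zeta>)))"
      using AE_not_path_image
    proof eventually_elim
      case (elim x)
      have "(\<integral>s. D s * (k x * ((1 - x * cnj \<zeta>) / ((x - \<zeta>) * (G s - x)))) \<partial>lborel)
          = (\<integral>s. (k x * ((1 - x * cnj \<zeta>) / (x - \<zeta>))) * (D s / (G s - x)) \<partial>lborel)"
        by (intro Bochner_Integration.integral_cong) auto
      also have "\<dots> = (k x * ((1 - x * cnj \<zeta>) / (x - \<zeta>))) * (2 * pi * \<i> * e * indicator I x)"
        by (simp only: integral_mult_right_zero e[OF elim])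
      finally show ?case by (simp add: mult_ac indicator_def)
    qed
  qed measurable
  also have "\<dots> = 2 * pi * \<i> * e * (\<integral>x. k x * indicator I x * ((1 - x * cnj \<zeta>) / (x - \<zeta>)) \<partial>lborel)"
    by (rule integral_mult_right_zero)
  finally have "4 * pi * (\<integral>s. D s * kern (G s) \<zeta> \<partial>lborel) = 4 * pi * (\<i> * e / 2 * (\<integral>x. k x * indicator I x * ((1 - x * cnj \<zeta>) / (x - \<zeta>)) \<partial>lborel))"
    by (simp add: field_simps)
  then show ?thesis by (simp only: mult_cancel_left \<zeta>_def) simp
qed

text \<open>This is Green's formula: the exterior derivative of cnj z / (1 - |z|^2) dz is i / 2
  times the area form. It is obtained from the potential of the cut-off density and one exchange, so
  no regularity of the enclosed domain enters.\<close>

lemma area_loop_integral: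
  assumes e: "\<And>x. x \<notin> path_image p \<Longrightarrow> (\<integral>t. D t / (G t - x) \<partial>lborel) = 2 * pi * \<i> * e * indicator I x"
  shows "(\<integral>t. D t * (cnj (G t) / (1 - (cmod (G t))\<^sup>2)) \<partial>lborel) = \<i> * e / 2 * area"
proof -
  have "4 * pi * (\<integral>t. D t * (cnj (G t) / (1 - (cmod (G t))\<^sup>2)) \<partial>lborel)
      = (\<integral>t. 4 * pi * (D t * (cnj (G t) / (1 - (cmod (G t))\<^sup>2))) \<partial>lborel)"
    by (rule integral_mult_right_zero[symmetric])
  also have "\<dots> = (\<integral>t. \<integral>x. D t * (k x / (G t - x)) \<partial>lborel \<partial>lborel)"
  proof (rule Bochner_Integration.integral_cong[OF refl])
    fix t
    have "(\<integral>x. D t * (k x / (G t - x)) \<partial>lborel) = D t * (4 * pi * cnj (G t) / (1 - (cmod (G t))\<^sup>2))"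
      using R by (simp only: integral_mult_right_zero hyp_potential[OF _ _ G_less] less_imp_le)
    then show "4 * pi * (D t * (cnj (G t) / (1 - (cmod (G t))\<^sup>2))) = (\<integral>x. D t * (k x / (G t - x)) \<partial>lborel)"
      by (simp add: mult_ac)
  qed
  also have "\<dots> = (\<integral>x. \<integral>t. D t * (k x / (G t - x)) \<partial>lborel \<partial>lborel)"
  proof (rule fubini_kernel[where B = M])
    fix t x
    have "cmod (D t) * (k x / cmod (G t - x)) \<le> M * indicator {0..1} t * (k x / cmod (G t - x))"
      by (intro mult_right_mono D_le) (simp add: trunc_density_nonneg)
    then show "cmod (D t * (k x / (G t - x))) \<le> M * indicator {0..1} t * (k x / cmod (x - G t))"
      by (simp add: norm_mult norm_divide trunc_density_nonneg norm_minus_commute)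
  qed (use M_nonneg in measurable)
  also have "\<dots> = (\<integral>x. 2 * pi * \<i> * e * complex_of_real (k x * indicator I x) \<partial>lborel)"
  proof (rule integral_cong_AE)
    show "AE x in lborel. (\<integral>t. D t * (k x / (G t - x)) \<partial>lborel) = 2 * pi * \<i> * e * complex_of_real (k x * indicator I x)"
      using AE_not_path_image
    proof eventually_elim
      case (elim x)
      have "(\<integral>t. D t * (k x / (G t - x)) \<partial>lborel) = (\<integral>t. k x * (D t / (G t - x)) \<partial>lborel)"
        by (intro Bochner_Integration.integral_cong) auto
      also have "\<dots> = k x * (2 * pi * \<i> * e * indicator I x)"
        by (simp only: integral_mult_right_zero e[OF elim])
      finally show ?case by (simp add: mult_ac indicator_def)
    qed
  qed measurable
  also have "\<dots> = 2 * pi * \<i> * e * area"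
    by (simp only: integral_mult_right_zero integral_complex_of_real area_eq)
  finally have "4 * pi * (\<integral>t. D t * (cnj (G t) / (1 - (cmod (G t))\<^sup>2)) \<partial>lborel) = 4 * pi * (\<i> * e / 2 * area)"
    by (simp add: field_simps)
  then show ?thesis by (simp only: mult_cancel_left) simp
qed


text \<open>Integrating over x after both loops gives (i e / 2) * (- i e (2 pi + A / 2)) * A, which
  is A (4 pi + A) / 4. The missing factor 4 is the product of the two factors 2 in the length
  elements.\<close>

lemma double_loop_integral:
  "(\<integral>t. D t / (1 - (cmod (G t))\<^sup>2) * (\<integral>s. D s * kern (G s) (G t) \<partial>lborel) \<partial>lborel)
    = of_real (area * (4 * pi + area) / 4)"
proof -
  obtain e where ee: "e * e = 1" and
    e: "\<And>x. x \<notin> path_image p \<Longrightarrow> (\<integral>t. D t / (G t - x) \<partial>lborel) = 2 * pi * \<i> * e * indicator I x"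
    using winding_integral_sign by blast
  define q where "q = (\<lambda>t x. D t / (1 - (cmod (G t))\<^sup>2) * (k x * indicator I x * ((1 - x * cnj (G t)) / (x - G t))))"
  have "(\<integral>t. D t / (1 - (cmod (G t))\<^sup>2) * (\<integral>s. D s * kern (G s) (G t) \<partial>lborel) \<partial>lborel)
     = (\<integral>t. \<i> * e / 2 * (\<integral>x. q t x \<partial>lborel) \<partial>lborel)"
  proof (rule integral_cong_AE)
    show "AE t in lborel. D t / (1 - (cmod (G t))\<^sup>2) * (\<integral>s. D s * kern (G s) (G t) \<partial>lborel) = \<i> * e / 2 * (\<integral>x. q t x \<partial>lborel)"
      using AE_regular
    proof eventually_elim
      case (elim t)
      show ?case
      \<comment> \<open>Where the velocity vanishes there is no chord bound, but the outer factor
        \<open>D t\<close> makes both sides 0.\<close>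
      proof (cases "D t = 0")
        case False
        then have "t \<in> {0..1}" using D_zero by blast
        then have t: "t \<in> {0<..<1} - S" using elim by (auto simp: less_le)
        define X where "X = (\<integral>x. k x * indicator I x * ((1 - x * cnj (G t)) / (x - G t)) \<partial>lborel)"
        have "(\<integral>s. D s * kern (G s) (G t) \<partial>lborel) = \<i> * e / 2 * X"
          unfolding X_def by (rule inner_loop_integral[OF e t False])
        moreover have "(\<integral>x. q t x \<partial>lborel) = D t / (1 - (cmod (G t))\<^sup>2) * X"
          unfolding X_def q_def by (rule integral_mult_right_zero)
        ultimately show ?thesis by (simp only: mult_ac)
      qed (simp add: q_def)
    qed
  qed (simp_all add: q_def)
  also have "\<dots> = \<i> * e / 2 * (\<integral>t. \<integral>x. q t x \<partial>lborel \<partial>lborel)"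
    by (rule integral_mult_right_zero)
  also have "(\<integral>t. \<integral>x. q t x \<partial>lborel \<partial>lborel) = (\<integral>x. \<integral>t. q t x \<partial>lborel \<partial>lborel)"
  \<comment> \<open>Speed at most M, conformal factor at most 1 / (1 - R^2), numerator at most
    2.\<close>
  proof (rule fubini_kernel[where B = "2 * M / (1 - R\<^sup>2)"])
    have R2: "R\<^sup>2 < 1" using R by (simp add: abs_square_less_1)
    then show "0 \<le> 2 * M / (1 - R\<^sup>2)" using M_nonneg by simp
    fix t x
    have "cmod (q t x) = cmod (D t) * (1 / (1 - (cmod (G t))\<^sup>2)) * (k x * cmod (1 - x * cnj (G t)) * indicator I x / cmod (x - G t))"
    proof -
      have "cmod (1 - complex_of_real ((cmod (G t))\<^sup>2)) = 1 - (cmod (G t))\<^sup>2"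
        using G_sq[of t] by (metis abs_of_pos norm_of_real of_real_1 of_real_diff)
      then show ?thesis
        by (simp add: q_def norm_mult norm_divide trunc_density_nonneg del: of_real_power)
    qed
    also have "\<dots> \<le> (M * indicator {0..1} t) * (1 / (1 - R\<^sup>2)) * (2 * k x / cmod (x - G t))"
    proof -
      have "k x * cmod (1 - x * cnj (G t)) * indicator I x \<le> 2 * k x"
        using k_kernel_le[OF G_less1[of t], of x] trunc_density_nonneg[of R x] by (simp add: indicator_def)
      from mult_mono[OF mult_mono[OF D_le G_sq_bound] divide_right_mono[OF this]] show ?thesis
        using M_nonneg R2 G_sq[of t] trunc_density_nonneg[of R x] by (simp add: less_imp_le)
    qed
    also have "\<dots> = 2 * M / (1 - R\<^sup>2) * indicator {0..1} t * (k x / cmod (x - G t))" by simp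
    finally show "cmod (q t x) \<le> 2 * M / (1 - R\<^sup>2) * indicator {0..1} t * (k x / cmod (x - G t))" .
  qed (simp add: q_def)
  also have "\<dots> = (\<integral>x. - (\<i> * e * (2 * pi + area / 2)) * complex_of_real (k x * indicator I x) \<partial>lborel)"
  proof (rule integral_cong_AE)
    show "AE x in lborel. (\<integral>t. q t x \<partial>lborel) = - (\<i> * e * (2 * pi + area / 2)) * complex_of_real (k x * indicator I x)"
      using AE_not_path_image
    proof eventually_elim
      case (elim x)
      let ?a = "\<lambda>t. D t / (G t - x)" and ?b = "\<lambda>t. D t * (cnj (G t) / (1 - (cmod (G t))\<^sup>2))"
      have A: "(\<integral>t. ?b t \<partial>lborel) = \<i> * e / 2 * area" by (rule area_loop_integral[OF e])
      have int_b: "integrable lborel ?b"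
      proof (rule integrable_bounded_on_unit[where B = "M * (1 / (1 - R\<^sup>2))"])
        fix t
        have "cmod (1 - complex_of_real ((cmod (G t))\<^sup>2)) = 1 - (cmod (G t))\<^sup>2"
          using G_sq[of t] by (metis abs_of_pos norm_of_real of_real_1 of_real_diff)
        then have "cmod (?b t) = cmod (D t) * cmod (G t) * (1 / (1 - (cmod (G t))\<^sup>2))"
          by (simp add: norm_mult norm_divide del: of_real_power)
        also have "\<dots> \<le> (M * indicator {0..1} t) * 1 * (1 / (1 - R\<^sup>2))"
          using G_sq[of t] G_less1[of t] M_nonneg
          by (intro mult_mono D_le G_sq_bound) (auto simp: less_imp_le)
        finally show "cmod (?b t) \<le> M * (1 / (1 - R\<^sup>2)) * indicator {0..1} t" by (simp add: mult_ac)
      qed simp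
      \<comment> \<open>The split into a Cauchy kernel and the form of
        \<open>area_loop_integral\<close>; it uses (1 - |\<zeta>|^2) - cnj \<zeta> (x - \<zeta>) = 1
        - x cnj \<zeta>.\<close>
      have pw: "q t x = (k x * indicator I x) * (- ?a t - ?b t)" for t
      proof -
        have ne: "x - G t \<noteq> 0" "G t - x \<noteq> 0" using elim G_image[of t] by auto
        have n: "complex_of_real (1 - (cmod (G t))\<^sup>2) = 1 - G t * cnj (G t)"
          by (simp only: of_real_diff of_real_1 complex_norm_square)
        have n0: "1 - G t * cnj (G t) \<noteq> 0"
          unfolding n[symmetric] using G_sq[of t] by (simp only: of_real_eq_0_iff)
        have eq: "D t / (1 - G t * cnj (G t)) * ((1 - x * cnj (G t)) / (x - G t))
           = - (D t / (G t - x)) - D t * (cnj (G t) / (1 - G t * cnj (G t)))"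
          using ne n0 by (simp add: divide_simps) (simp add: algebra_simps)
        have "q t x = (k x * indicator I x) * (D t / (1 - G t * cnj (G t)) * ((1 - x * cnj (G t)) / (x - G t)))"
          unfolding q_def n by (simp only: mult_ac)
        then show ?thesis unfolding eq n .
      qed
      have "(\<integral>t. q t x \<partial>lborel) = (k x * indicator I x) * (- (\<integral>t. ?a t \<partial>lborel) - (\<integral>t. ?b t \<partial>lborel))"
        unfolding pw
        by (simp only: integral_mult_right_zero Bochner_Integration.integral_minus
          Bochner_Integration.integral_diff[OF Bochner_Integration.integrable_minus[OF winding_integral(2)[OF elim]] int_b])
      also have "\<dots> = - (\<i> * e * (2 * pi + area / 2)) * complex_of_real (k x * indicator I x)"
        unfolding A e[OF elim] by (simp add: indicator_def algebra_simps)
      finally show ?case .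
    qed
  qed (simp_all add: q_def)
  also have "\<dots> = - (\<i> * e * (2 * pi + area / 2)) * area"
    by (simp only: integral_mult_right_zero integral_complex_of_real area_eq)
  also have "\<i> * e / 2 * \<dots> = (e * e) * ((2 * pi + area / 2) * area / 2)" by (simp add: algebra_simps)
  also have "\<dots> = of_real (area * (4 * pi + area) / 4)" unfolding ee by (simp add: algebra_simps)
  finally show ?thesis .
qed

lemma len_integrable: "integrable lborel (\<lambda>t. 2 * cmod (D t) / (1 - (cmod (G t))\<^sup>2))"
proof (rule Bochner_Integration.integrable_bound)
  show "integrable lborel (\<lambda>t. 2 * M / (1 - R\<^sup>2) * indicator {0..1::real} t)" by simp
  show "AE t in lborel. norm (2 * cmod (D t) / (1 - (cmod (G t))\<^sup>2)) \<le> norm (2 * M / (1 - R\<^sup>2) * indicator {0..1} t)"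
  proof (rule AE_I2)
    fix t
    have "2 * cmod (D t) * (1 / (1 - (cmod (G t))\<^sup>2)) \<le> 2 * (M * indicator {0..1} t) * (1 / (1 - R\<^sup>2))"
      using G_sq[of t] M_nonneg by (intro mult_mono D_le G_sq_bound) (auto simp: less_imp_le)
    then have "2 * cmod (D t) / (1 - (cmod (G t))\<^sup>2) \<le> 2 * M / (1 - R\<^sup>2) * indicator {0..1} t" by (simp add: mult_ac)
    moreover have "0 \<le> 2 * cmod (D t) / (1 - (cmod (G t))\<^sup>2)" using G_sq[of t] by simp
    ultimately show "norm (2 * cmod (D t) / (1 - (cmod (G t))\<^sup>2)) \<le> norm (2 * M / (1 - R\<^sup>2) * indicator {0..1} t)"
      by (simp only: real_norm_def abs_of_nonneg order_trans[OF _ abs_ge_self])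
  qed
qed measurable

text \<open>The quotient cnj (z - \<zeta>) / (z - \<zeta>) has modulus at most 1, so the absolute
  value of the double integral is at most the square of the integral of \<open>u\<close>, the half
  length element.\<close>

theorem isoperimetric_inequality: "area * (4 * pi + area) \<le> len\<^sup>2"
proof -
  define u where "u = (\<lambda>t. cmod (D t) / (1 - (cmod (G t))\<^sup>2))"
  have u_int: "integrable lborel u"
    using integrable_mult_right[OF len_integrable, of "1/2"] by (simp add: u_def)
  have len: "len = 2 * (\<integral>t. u t \<partial>lborel)"
    unfolding len_def u_def integral_mult_right_zero[symmetric] by (simp add: mult_ac)
  have norm1: "cmod (1 - complex_of_real ((cmod (G t))\<^sup>2)) = 1 - (cmod (G t))\<^sup>2" for t
    using G_sq[of t] by (metis abs_of_pos norm_of_real of_real_1 of_real_diff)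
  have u0: "0 \<le> u t" for t using G_sq[of t] by (simp add: u_def)
  have kern_le: "cmod (D s * kern (G s) z) \<le> u s" for s z
  proof -
    \<comment> \<open>An inequality only: at \<open>G s = z\<close> the quotient is 0 by
      convention.\<close>
    have "cmod (cnj (G s - z)) / cmod (G s - z) \<le> 1" by (subst complex_mod_cnj) simp
    then have "(cmod (cnj (G s - z)) / cmod (G s - z)) * u s \<le> 1 * u s" by (intro mult_right_mono u0)
    moreover have "cmod (D s * kern (G s) z) = (cmod (cnj (G s - z)) / cmod (G s - z)) * u s"
      unfolding kern_def norm_mult norm_divide u_def using norm1[of s] by (simp del: of_real_power)
    ultimately show ?thesis by simp
  qed
  have inner: "cmod (\<integral>s. D s * kern (G s) z \<partial>lborel) \<le> (\<integral>s. u s \<partial>lborel)" for z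
  proof -
    have "cmod (\<integral>s. D s * kern (G s) z \<partial>lborel) \<le> (\<integral>s. cmod (D s * kern (G s) z) \<partial>lborel)"
      by (rule integral_norm_bound)
    also have "\<dots> \<le> (\<integral>s. u s \<partial>lborel)"
      by (rule integral_mono'[OF u_int kern_le u0])
    finally show ?thesis .
  qed
  have "cmod (\<integral>t. D t / (1 - (cmod (G t))\<^sup>2) * (\<integral>s. D s * kern (G s) (G t) \<partial>lborel) \<partial>lborel)
     \<le> (\<integral>t. cmod (D t / (1 - (cmod (G t))\<^sup>2) * (\<integral>s. D s * kern (G s) (G t) \<partial>lborel)) \<partial>lborel)"
    by (rule integral_norm_bound)
  also have "\<dots> \<le> (\<integral>t. u t * (\<integral>s. u s \<partial>lborel) \<partial>lborel)"
  proof (rule integral_mono')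
    show "integrable lborel (\<lambda>t. u t * (\<integral>s. u s \<partial>lborel))" using u_int by (rule integrable_mult_left)
    have U: "0 \<le> (\<integral>s. u s \<partial>lborel)" by (intro integral_nonneg_AE AE_I2 u0)
    fix t
    show "0 \<le> u t * (\<integral>s. u s \<partial>lborel)" using u0 U by simp
    have "cmod (D t / (1 - (cmod (G t))\<^sup>2) * (\<integral>s. D s * kern (G s) (G t) \<partial>lborel)) = u t * cmod (\<integral>s. D s * kern (G s) (G t) \<partial>lborel)"
      unfolding norm_mult norm_divide u_def using norm1[of t] by (simp del: of_real_power)
    also have "\<dots> \<le> u t * (\<integral>s. u s \<partial>lborel)" by (intro mult_left_mono inner u0)
    finally show "cmod (D t / (1 - (cmod (G t))\<^sup>2) * (\<integral>s. D s * kern (G s) (G t) \<partial>lborel)) \<le> u t * (\<integral>s. u s \<partial>lborel)" .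
  qed
  also have "\<dots> = (len / 2)\<^sup>2" by (simp add: len power2_eq_square)
  finally have "\<bar>area * (4 * pi + area) / 4\<bar> \<le> (len / 2)\<^sup>2"
    unfolding double_loop_integral norm_of_real .
  then show ?thesis by (simp add: power_divide)
qed

end

section \<open>Volume densities of a Randers norm\<close>

lemma partial_deriv_eqI:
  assumes "(h has_derivative h') (at x)"
  shows "partial_deriv i h x = h' (axis i 1)"
  using frechet_derivative_at[OF assms] by (simp add: partial_deriv_def)

lemma partial_deriv_square_randers:
  fixes b y :: "real^'n"
  assumes "y \<noteq> 0"
  shows "partial_deriv j (\<lambda>z. (l * norm z + b \<bullet> z)\<^sup>2) y
       = 2 * (l * norm y + b \<bullet> y) * (l * (y $ j / norm y) + b $ j)"
proof -
  have "((\<lambda>z. (l * norm z + b \<bullet> z)\<^sup>2) has_derivative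
      (\<lambda>h. 2 * (l * norm y + b \<bullet> y) * (l * (h \<bullet> sgn y) + b \<bullet> h))) (at y)"
    by (rule has_derivative_eq_rhs, (rule has_derivative_power has_derivative_mult has_derivative_add has_derivative_const
          has_derivative_norm[OF assms] has_derivative_inner_right has_derivative_ident)+)
       (simp add: fun_eq_iff inner_commute algebra_simps)
  from partial_deriv_eqI[OF this, of j] show ?thesis
    by (simp add: inner_axis inner_axis' sgn_div_norm divide_inverse mult_ac)
qed

text \<open>Half the Hessian of F^2 is dF dF^T + F Hess F. With u = y / |y|, dF is l u + b, and Hess
  F is l / |y| times the projection orthogonal to u.\<close>

lemma fundamental_tensor_randers:
  fixes F :: "real^'n \<Rightarrow> real^'n \<Rightarrow> real"
  assumes F: "\<And>y. F x y = l * norm y + b \<bullet> y" and y: "y \<noteq> 0"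
  shows "fundamental_tensor F x y $ i $ j
    = (l * (y $ i / norm y) + b $ i) * (l * (y $ j / norm y) + b $ j)
      + F x y * l / norm y * ((if i = j then 1 else 0) - (y $ i / norm y) * (y $ j / norm y))"
proof -
  have n: "norm y \<noteq> 0" using y by simp
  define g where "g = (\<lambda>z. 2 * (l * norm z + b \<bullet> z) * (l * (z $ j / norm z) + b $ j))"
  have "(g has_derivative (\<lambda>h. 2 * (l * (h \<bullet> sgn y) + b \<bullet> h) * (l * (y $ j / norm y) + b $ j)
      + 2 * (l * norm y + b \<bullet> y) * (l * ((h $ j * norm y - y $ j * (h \<bullet> sgn y)) / (norm y)\<^sup>2)))) (at y)"
    unfolding g_def
    by (rule has_derivative_eq_rhs, (rule has_derivative_mult has_derivative_add has_derivative_const has_derivative_divide'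
          has_derivative_norm[OF y] has_derivative_inner_right has_derivative_ident
          bounded_linear.has_derivative[OF bounded_linear_vec_nth] n)+)
       (simp add: fun_eq_iff inner_commute power2_eq_square algebra_simps y)
  \<comment> \<open>The first partial derivative equals \<open>g\<close> only off the origin, an
    open set that contains y.\<close>
  then have "(partial_deriv j (\<lambda>z. (F x z)\<^sup>2) has_derivative (\<lambda>h. 2 * (l * (h \<bullet> sgn y) + b \<bullet> h) * (l * (y $ j / norm y) + b $ j)
      + 2 * (l * norm y + b \<bullet> y) * (l * ((h $ j * norm y - y $ j * (h \<bullet> sgn y)) / (norm y)\<^sup>2)))) (at y)"
    by (rule has_derivative_transform_within_open[where s = "- {0}"])
       (use y in \<open>auto simp: F partial_deriv_square_randers g_def\<close>)
  note D = partial_deriv_eqI[OF this, of i]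
  have ax: "axis i 1 \<bullet> sgn y = y $ i / norm y" "b \<bullet> axis i 1 = b $ i" by (simp_all add: inner_axis inner_axis' sgn_div_norm divide_inverse mult.commute)
  have ax': "axis i (1::real) $ j = (if i = j then 1 else 0)" by (simp add: axis_def)
  have "fundamental_tensor F x y $ i $ j = 1/2 * partial_deriv i (partial_deriv j (\<lambda>z. (F x z)\<^sup>2)) y"
    by (simp add: fundamental_tensor_def)
  also have "\<dots> = (l * (y $ i / norm y) + b $ i) * (l * (y $ j / norm y) + b $ j)
      + (l * norm y + b \<bullet> y) * l * (((if i = j then 1 else 0) * norm y - y $ j * (y $ i / norm y)) / (norm y)\<^sup>2)"
    unfolding D ax ax' by (simp only: mult.assoc) (simp add: algebra_simps)
  also have "((if i = j then 1 else 0) * norm y - y $ j * (y $ i / norm y)) / (norm y)\<^sup>2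
      = ((if i = j then 1 else 0) - (y $ i / norm y) * (y $ j / norm y)) / norm y"
    using n by (simp add: field_simps power2_eq_square)
  finally show ?thesis by (simp add: F)
qed

text \<open>With \<open>u = y / |y|\<close>, \<open>p = l u + b\<close> and \<open>w\<close> the unit normal to \<open>u\<close>, the tensor is
  \<open>p p\<^sup>T + (F l / |y|) w w\<^sup>T\<close>, and \<open>p \<bullet> u = F / |y|\<close> by Euler's relation.\<close>

lemma det_fundamental_tensor_randers:
  fixes F :: "real^2 \<Rightarrow> real^2 \<Rightarrow> real"
  assumes F: "\<And>y. F x y = l * norm y + b \<bullet> y" and y: "y \<noteq> 0"
  shows "det (fundamental_tensor F x y) = l * (F x y / norm y) ^ 3"
proof -
  define u where "u i = y $ i / norm y" for i
  define p where "p i = l * u i + b $ i" for i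
  define s where "s = F x y * l / norm y"
  have n: "norm y > 0" using y by simp
  have "(norm y)\<^sup>2 = (y$1)\<^sup>2 + (y$2)\<^sup>2" by (simp add: norm_vec_def L2_set_def sum_2)
  then have "(u 1)\<^sup>2 + (u 2)\<^sup>2 = (norm y)\<^sup>2 / (norm y)\<^sup>2"
    by (simp only: u_def power_divide add_divide_distrib)
  then have u1: "(u 1)\<^sup>2 + (u 2)\<^sup>2 = 1" using n by simp
  have M: "fundamental_tensor F x y $ i $ j = p i * p j + s * ((if i = j then 1 else 0) - u i * u j)" for i j
    unfolding fundamental_tensor_randers[where F = F and x = x, OF F y] by (simp add: u_def p_def s_def)
  have "det (fundamental_tensor F x y) = (p 1 * p 1 + s * (1 - u 1 * u 1)) * (p 2 * p 2 + s * (1 - u 2 * u 2)) - (p 1 * p 2 - s * (u 1 * u 2)) * (p 1 * p 2 - s * (u 1 * u 2))"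
    unfolding det_2 M by (simp add: mult_ac)
  also have "\<dots> = s * (p 1 * u 1 + p 2 * u 2)\<^sup>2"
  proof -
    have f: "1 - u 1 * u 1 = u 2 * u 2" "1 - u 2 * u 2 = u 1 * u 1" using u1 by (simp_all add: power2_eq_square)
    show ?thesis unfolding f by (simp add: power2_eq_square algebra_simps)
  qed
  also have "p 1 * u 1 + p 2 * u 2 = F x y / norm y"
  proof -
    have "p 1 * u 1 + p 2 * u 2 = l * ((u 1)\<^sup>2 + (u 2)\<^sup>2) + (b $ 1 * u 1 + b $ 2 * u 2)"
      by (simp add: p_def power2_eq_square algebra_simps)
    also have "b $ 1 * u 1 + b $ 2 * u 2 = (b \<bullet> y) / norm y"
      by (simp add: u_def inner_vec_def sum_2 add_divide_distrib)
    finally show ?thesis using n by (simp add: u1 F field_simps)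
  qed
  finally show ?thesis by (simp add: s_def power2_eq_square power3_eq_cube mult_ac)
qed

lemma det_fundamental_tensor_indicatrix:
  fixes F :: "real^2 \<Rightarrow> real^2 \<Rightarrow> real"
  assumes F: "\<And>y. F x y = l * norm y + b \<bullet> y" and y: "y \<in> indicatrix F x"
  shows "det (fundamental_tensor F x y) = l * (1 / norm y) ^ 3" "0 < norm y"
proof -
  have "y \<noteq> 0" using y F[of 0] by (auto simp: indicatrix_def)
  then show "det (fundamental_tensor F x y) = l * (1 / norm y) ^ 3" "0 < norm y"
    using det_fundamental_tensor_randers[where F = F and x = x, OF F, of y] y by (simp_all add: indicatrix_def)
qed

text \<open>For b = 0 any unit vector serves, so the case of a vanishing 1-form needs no separate
  treatment below.\<close>

lemma exists_unit_direction:
  fixes b :: "'a::euclidean_space"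
  obtains e where "norm e = 1" "b = norm b *\<^sub>R e"
proof (cases "b = 0")
  case True
  obtain e :: 'a where "e \<in> Basis" using nonempty_Basis by blast
  with True that[of e] show thesis by simp
next
  case False
  then show thesis using that[of "b /\<^sub>R norm b"] by simp
qed

lemma sqrt_scale: "0 \<le> (l::real) \<Longrightarrow> sqrt (l * (l * r) ^ 3) = sqrt (r ^ 3) * l\<^sup>2"
proof -
  assume l: "0 \<le> l"
  have "l * (l * r) ^ 3 = r ^ 3 * (l\<^sup>2)\<^sup>2" by (simp add: power_mult_distrib power2_eq_square power3_eq_cube mult_ac)
  then show ?thesis by (simp only: real_sqrt_mult real_sqrt_abs abs_power2)
qed

text \<open>On the indicatrix the determinant is l / |y|^3, so the shortest y is sought.
  Cauchy-Schwarz gives |y| \<ge> 1 / (l (1 + c)), with equality in the direction of b.\<close>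

lemma sigma_max_randers:
  fixes F :: "real^2 \<Rightarrow> real^2 \<Rightarrow> real"
  assumes F: "\<And>y. F x y = l * norm y + b \<bullet> y" and l: "0 < l" and b: "norm b = c * l" and c: "0 \<le> c" 
  shows "sigma_max F x = sqrt ((1 + c) ^ 3) * l\<^sup>2"
  unfolding sigma_max_def
proof (rule cSup_eq_maximum)
  obtain e where e: "norm e = 1" "b = norm b *\<^sub>R e" using exists_unit_direction .
  define y where "y = (1 / (l * (1 + c))) *\<^sub>R e"
  have ee: "e \<bullet> e = 1" using e(1) by (simp add: norm_eq_1)
  have ny: "norm y = 1 / (l * (1 + c))" using e(1) l c by (simp add: y_def)
  have "b \<bullet> y = c * l / (l * (1 + c))" by (subst e(2)) (simp add: y_def b ee)
  then have "F x y = (l + c * l) / (l * (1 + c))" using l c unfolding F ny by (simp add: add_divide_distrib)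
  also have "l + c * l = l * (1 + c)" by (simp add: algebra_simps)
  also have "l * (1 + c) / (l * (1 + c)) = 1" using l c by simp
  finally have yI: "y \<in> indicatrix F x" by (simp add: indicatrix_def)
  have "sqrt (det (fundamental_tensor F x y)) = sqrt ((1 + c) ^ 3) * l\<^sup>2"
    unfolding det_fundamental_tensor_indicatrix(1)[where F = F and x = x, OF F yI] ny using l by (simp add: sqrt_scale)
  then show "sqrt ((1 + c) ^ 3) * l\<^sup>2 \<in> (\<lambda>y. sqrt (det (fundamental_tensor F x y))) ` indicatrix F x"
    using yI by force
next
  fix v assume "v \<in> (\<lambda>y. sqrt (det (fundamental_tensor F x y))) ` indicatrix F x"
  then obtain y where y: "y \<in> indicatrix F x" "v = sqrt (det (fundamental_tensor F x y))" by blast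
  note d = det_fundamental_tensor_indicatrix[where F = F and x = x, OF F y(1)]
  have "1 = F x y" using y(1) by (simp add: indicatrix_def)
  also have "\<dots> \<le> l * norm y + norm b * norm y" unfolding F using Cauchy_Schwarz_ineq2[of b y] by simp
  finally have "1 / norm y \<le> l * (1 + c)" using d(2) by (simp add: b field_simps)
  then have "l * (1 / norm y) ^ 3 \<le> l * (l * (1 + c)) ^ 3" using l d(2) by (intro mult_left_mono power_mono) auto
  then have "v \<le> sqrt (l * (l * (1 + c)) ^ 3)" unfolding y(2) d(1) by simp
  then show "v \<le> sqrt ((1 + c) ^ 3) * l\<^sup>2" using l by (simp add: sqrt_scale)
qed

text \<open>Now the longest y counts: it points against b and has length 1 / (l (1 - c)), finite
  because c < 1.\<close>

lemma sigma_min_randers: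
  fixes F :: "real^2 \<Rightarrow> real^2 \<Rightarrow> real"
  assumes F: "\<And>y. F x y = l * norm y + b \<bullet> y" and l: "0 < l" and b: "norm b = c * l" and c: "0 \<le> c" "c < 1"
  shows "sigma_min F x = sqrt ((1 - c) ^ 3) * l\<^sup>2"
  unfolding sigma_min_def
proof (rule cInf_eq_minimum)
  obtain e where e: "norm e = 1" "b = norm b *\<^sub>R e" using exists_unit_direction .
  define y where "y = (- 1 / (l * (1 - c))) *\<^sub>R e"
  have ee: "e \<bullet> e = 1" using e(1) by (simp add: norm_eq_1)
  have ny: "norm y = 1 / (l * (1 - c))" using e(1) l c by (simp add: y_def)
  have "b \<bullet> y = - (c * l / (l * (1 - c)))" by (subst e(2)) (simp add: y_def b ee)
  then have "F x y = (l - c * l) / (l * (1 - c))" using l c unfolding F ny by (simp add: diff_divide_distrib)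
  also have "l - c * l = l * (1 - c)" by (simp add: algebra_simps)
  also have "l * (1 - c) / (l * (1 - c)) = 1" using l c by simp
  finally have yI: "y \<in> indicatrix F x" by (simp add: indicatrix_def)
  have "sqrt (det (fundamental_tensor F x y)) = sqrt ((1 - c) ^ 3) * l\<^sup>2"
    unfolding det_fundamental_tensor_indicatrix(1)[where F = F and x = x, OF F yI] ny using l by (simp add: sqrt_scale)
  then show "sqrt ((1 - c) ^ 3) * l\<^sup>2 \<in> (\<lambda>y. sqrt (det (fundamental_tensor F x y))) ` indicatrix F x"
    using yI by force
next
  fix v assume "v \<in> (\<lambda>y. sqrt (det (fundamental_tensor F x y))) ` indicatrix F x"
  then obtain y where y: "y \<in> indicatrix F x" "v = sqrt (det (fundamental_tensor F x y))" by blast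
  note d = det_fundamental_tensor_indicatrix[where F = F and x = x, OF F y(1)]
  have "l * norm y - norm b * norm y \<le> F x y" unfolding F using Cauchy_Schwarz_ineq2[of b y] by simp
  also have "\<dots> = 1" using y(1) by (simp add: indicatrix_def)
  finally have "l * (1 - c) \<le> 1 / norm y" using d(2) by (simp add: b field_simps)
  then have "l * (l * (1 - c)) ^ 3 \<le> l * (1 / norm y) ^ 3" using l c by (intro mult_left_mono power_mono) auto
  then have "sqrt (l * (l * (1 - c)) ^ 3) \<le> v" unfolding y(2) d(1) by simp
  then show "sqrt ((1 - c) ^ 3) * l\<^sup>2 \<le> v" using l by (simp add: sqrt_scale)
qed

section \<open>Reduction to a normal form that depends on c alone\<close>

lemma integral_scaled_rotation:
  fixes h :: "real^2 \<Rightarrow> real"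
  assumes [measurable]: "h \<in> borel_measurable borel" and l: "0 < l" and e: "cmod e = 1"
  shows "(\<integral>y. h y \<partial>lborel) = (\<integral>w. h (of_complex (e / l * w)) \<partial>lborel) / l\<^sup>2"
proof -
  have "(\<integral>y. h y \<partial>lborel) = (\<integral>z. h (of_complex z) \<partial>lborel)"
    by (subst distr_of_complex[symmetric]) (simp add: integral_distr)
  also have "\<dots> = (cmod (e / l))\<^sup>2 *\<^sub>R (\<integral>w. h (of_complex (e / l * w)) \<partial>lborel)"
    using l e by (intro integral_complex_mult) auto
  finally show ?thesis using l e by (simp add: norm_divide power_divide)
qed

text \<open>The norm l |y| + b \<bullet> y after b is rotated to the positive real axis and y is
  rescaled by l.\<close>

definition randers_model :: "real \<Rightarrow> complex \<Rightarrow> real" where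
  "randers_model c w = cmod w + c * Re w"

lemma measurable_randers_model [measurable]: "randers_model c \<in> borel_measurable borel"
  unfolding randers_model_def[abs_def] by measurable

lemma randers_rotate:
  assumes b: "b = (c * l) *\<^sub>R v" and v: "norm v = 1" and l: "0 < l"
  shows "l * norm (of_complex (to_complex v / l * w)) + b \<bullet> of_complex (to_complex v / l * w) = randers_model c w"
    and "norm (of_complex (to_complex v / l * w)) = cmod w / l"
proof -
  show n: "norm (of_complex (to_complex v / l * w)) = cmod w / l"
    using v l by (simp add: norm_mult norm_divide)
  have v2: "(v$1)\<^sup>2 + (v$2)\<^sup>2 = 1"
    using v by (simp add: norm_vec_def L2_set_def sum_2)
  have "b \<bullet> of_complex (to_complex v / l * w) = c * (((v$1)\<^sup>2 + (v$2)\<^sup>2) * Re w)"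
    using l by (simp add: b inner_vec_def sum_2 Re_divide_of_real Im_divide_of_real power2_eq_square field_simps)
  then show "l * norm (of_complex (to_complex v / l * w)) + b \<bullet> of_complex (to_complex v / l * w) = randers_model c w"
    using l unfolding n by (simp add: v2 randers_model_def)
qed

lemma measure_randers_ball:
  fixes b :: "real^2"
  assumes l: "0 < l" and b: "norm b = c * l"
  shows "measure lborel {y. l * norm y + b \<bullet> y < 1} = measure lborel {w. randers_model c w < 1} / l\<^sup>2"
proof -
  obtain v where v: "norm v = 1" "b = norm b *\<^sub>R v" using exists_unit_direction .
  have "measure lborel {y. l * norm y + b \<bullet> y < 1} = (\<integral>y. indicator {y. l * norm y + b \<bullet> y < 1} y \<partial>lborel)"
    by simp
  also have "\<dots> = (\<integral>w. indicator {y. l * norm y + b \<bullet> y < 1} (of_complex (to_complex v / l * w)) \<partial>lborel) / l\<^sup>2"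
    by (rule integral_scaled_rotation) (use l v in auto)
  also have "(\<lambda>w. indicator {y. l * norm y + b \<bullet> y < 1} (of_complex (to_complex v / l * w)) :: real) = indicator {w. randers_model c w < 1}"
    using randers_rotate(1)[of b c l v] v b l by (auto simp: indicator_def fun_eq_iff)
  finally show ?thesis by simp
qed

lemma sigma_BH_randers:
  fixes F :: "real^2 \<Rightarrow> real^2 \<Rightarrow> real"
  assumes F: "\<And>y. F x y = l * norm y + b \<bullet> y" and l: "0 < l" and b: "norm b = c * l"
  shows "sigma_BH F x = measure lborel (ball (0::real^2) 1) / measure lborel {w. randers_model c w < 1} * l\<^sup>2"
  unfolding sigma_BH_def F measure_randers_ball[OF l b] by simp

lemma sigma_HT_randers:
  fixes F :: "real^2 \<Rightarrow> real^2 \<Rightarrow> real"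
  assumes F: "\<And>y. F x y = l * norm y + b \<bullet> y" and l: "0 < l" and b: "norm b = c * l"
  shows "sigma_HT F x = 1 / measure lborel (ball (0::real^2) 1)
     * (\<integral>w. indicator {w. randers_model c w < 1} w * (randers_model c w / cmod w) ^ 3 \<partial>lborel) * l\<^sup>2"
proof -
  obtain v where v: "norm v = 1" "b = norm b *\<^sub>R v" using exists_unit_direction .
  define h where "h = (\<lambda>y. indicator {y. l * norm y + b \<bullet> y < 1} y * (l * ((l * norm y + b \<bullet> y) / norm y) ^ 3))"
  have [measurable]: "h \<in> borel_measurable borel" unfolding h_def by measurable
  define h0 where "h0 = det (fundamental_tensor F x 0)"
  have det_eq: "det (fundamental_tensor F x y) = (if y = 0 then h0 else l * ((l * norm y + b \<bullet> y) / norm y) ^ 3)" for y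
    using det_fundamental_tensor_randers[where F = F and x = x, OF F, of y] by (simp add: h0_def F)
  have "set_lebesgue_integral lborel {y. F x y < 1} (\<lambda>y. det (fundamental_tensor F x y)) = (\<integral>y. h y \<partial>lborel)"
    unfolding set_lebesgue_integral_def det_eq F
  proof (rule integral_cong_AE)
    have "AE y in lborel. y \<noteq> (0::real^2)" by (rule AE_lborel_singleton)
    then show "AE y in lborel. indicat_real {y. l * norm y + b \<bullet> y < 1} y *\<^sub>R (if y = 0 then h0 else l * ((l * norm y + b \<bullet> y) / norm y) ^ 3) = h y"
      by eventually_elim (simp add: h_def)
  qed measurable
  also have "\<dots> = (\<integral>w. h (of_complex (to_complex v / l * w)) \<partial>lborel) / l\<^sup>2"
    by (rule integral_scaled_rotation) (use l v in auto)
  also have "(\<lambda>w. h (of_complex (to_complex v / l * w))) = (\<lambda>w. l ^ 4 * (indicator {w. randers_model c w < 1} w * (randers_model c w / cmod w) ^ 3))"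
  proof
    fix w
    have "b = (c * l) *\<^sub>R v" using v(2) b by simp
    note r = randers_rotate[OF this v(1) l]
    \<comment> \<open>One factor l comes from the determinant and three from |y| = |w| / l; the
      Jacobian removes two of them again.\<close>
    have "l * (randers_model c w / (cmod w / l)) ^ 3 = l ^ 4 * (randers_model c w / cmod w) ^ 3"
      by (simp add: power_mult_distrib power_divide power4_eq_xxxx power3_eq_cube)
    moreover have "indicat_real {y. l * norm y + b \<bullet> y < 1} (of_complex (to_complex v / l * w)) = indicator {w. randers_model c w < 1} w"
      by (simp only: indicator_def mem_Collect_eq r(1))
    ultimately show "h (of_complex (to_complex v / l * w)) = l ^ 4 * (indicator {w. randers_model c w < 1} w * (randers_model c w / cmod w) ^ 3)"
      unfolding h_def r(1) unfolding r(2) by (simp only: mult_ac)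
  qed
  finally show ?thesis
    using l by (simp add: sigma_HT_def power4_eq_xxxx power2_eq_square)
qed

text \<open>The factor \<open>q\<close> is quantified before F, x, l and b: it depends on c and the
  choice of density only. For two of the densities it stays an unevaluated integral or volume, since
  its value cancels from the comparison of areas.\<close>

lemma randers_density_const:
  assumes "\<sigma> \<in> {sigma_BH, sigma_HT, sigma_max, sigma_min}" and c: "0 \<le> c" "c < 1"
  obtains q where "0 \<le> q"
    "\<And>(F :: real^2 \<Rightarrow> real^2 \<Rightarrow> real) x l b. (\<And>y. F x y = l * norm y + b \<bullet> y) \<Longrightarrow> 0 < l \<Longrightarrow> norm b = c * l \<Longrightarrow> \<sigma> F x = q * l\<^sup>2"
proof -
  consider "\<sigma> = sigma_BH" | "\<sigma> = sigma_HT" | "\<sigma> = sigma_max" | "\<sigma> = sigma_min" using assms(1) by blast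
  then show thesis
  proof cases
    case 1
    show thesis
      by (rule that[of "measure lborel (ball (0::real^2) 1) / measure lborel {w. randers_model c w < 1}"])
         (simp_all add: 1 sigma_BH_randers)
  next
    case 2
    have m: "0 \<le> randers_model c w" for w
    proof -
      have "\<bar>c * Re w\<bar> \<le> 1 * cmod w" unfolding abs_mult using c abs_Re_le_cmod by (intro mult_mono) auto
      then show ?thesis by (simp add: randers_model_def)
    qed
    show thesis
    proof (rule that)
      show "0 \<le> 1 / measure lborel (ball (0::real^2) 1)
         * (\<integral>w. indicator {w. randers_model c w < 1} w * (randers_model c w / cmod w) ^ 3 \<partial>lborel)"
        using m by (intro mult_nonneg_nonneg integral_nonneg_AE AE_I2) auto
    qed (simp only: 2 sigma_HT_randers)
  next
    case 3
    show thesis by (rule that[of "sqrt ((1 + c) ^ 3)"]) (use c in \<open>simp_all add: 3 sigma_max_randers\<close>)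
  next
    case 4
    show thesis by (rule that[of "sqrt ((1 - c) ^ 3)"]) (use c in \<open>simp_all add: 4 sigma_min_randers\<close>)
  qed
qed

section \<open>Piecewise smooth closed curves\<close>

text \<open>The bound \<open>M\<close> is an argument because one bound has to serve all parameters
  off the break points.\<close>

definition regular_at :: "(real \<Rightarrow> real^'n) \<Rightarrow> real \<Rightarrow> real \<Rightarrow> bool" where
  "regular_at \<gamma> M t \<longleftrightarrow> (\<gamma> has_vector_derivative vector_derivative \<gamma> (at t)) (at t)
     \<and> norm (vector_derivative \<gamma> (at t)) \<le> M \<and> isCont (\<lambda>t. vector_derivative \<gamma> (at t)) t"

lemma regular_at_mono: "regular_at \<gamma> M t \<Longrightarrow> M \<le> M' \<Longrightarrow> regular_at \<gamma> M' t"
  by (auto simp: regular_at_def)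

text \<open>The derivative is continuous on the closed piece, so compactness bounds it up to the
  break points; two-sided differentiability is claimed only in between.\<close>

lemma smooth_arc_regular:
  assumes "smooth_arc u v \<gamma>"
  obtains M where "continuous_on {u..v} \<gamma>" "\<And>t. t \<in> {u<..<v} \<Longrightarrow> regular_at \<gamma> M t"
proof -
  obtain d where d0: "\<And>t. t \<in> {u..v} \<Longrightarrow> d 0 t = \<gamma> t"
    and d: "\<And>k t. t \<in> {u..v} \<Longrightarrow> (d k has_vector_derivative d (Suc k) t) (at t within {u..v})"
    using assms unfolding smooth_arc_def by blast
  have cont: "continuous_on {u..v} (d k)" for k
    unfolding continuous_on_eq_continuous_within
    by (intro ballI has_vector_derivative_continuous[OF d])
  have "continuous_on {u..v} \<gamma>" using cont[of 0] d0 by (rule continuous_on_eq)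
  moreover have "bounded (d 1 ` {u..v})"
    using cont by (intro compact_imp_bounded compact_continuous_image) auto
  then obtain M where M: "\<And>t. t \<in> {u..v} \<Longrightarrow> norm (d 1 t) \<le> M"
    unfolding bounded_iff by blast
  have der: "(\<gamma> has_vector_derivative d 1 t) (at t)" if t: "t \<in> {u<..<v}" for t
  proof -
    have "(d 0 has_vector_derivative d 1 t) (at t within {u..v})" using d[of t 0] t by simp
    then have "(d 0 has_vector_derivative d 1 t) (at t within {u<..<v})"
      by (rule has_vector_derivative_within_subset) auto
    then have "(d 0 has_vector_derivative d 1 t) (at t)"
      using t by (simp only: at_within_open[OF t open_greaterThanLessThan])
    then show ?thesis
      by (rule has_vector_derivative_transform_within_open[of _ _ _ "{u<..<v}"]) (use t d0 in auto)
  qed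
  have "regular_at \<gamma> M t" if t: "t \<in> {u<..<v}" for t
    unfolding regular_at_def
  proof (intro conjI)
    have v: "vector_derivative \<gamma> (at t) = d 1 t" if "t \<in> {u<..<v}" for t
      using der[OF that] by (rule vector_derivative_at)
    show "(\<gamma> has_vector_derivative vector_derivative \<gamma> (at t)) (at t)" "norm (vector_derivative \<gamma> (at t)) \<le> M"
      using der[OF t] M[of t] t by (simp_all add: v)
    have "continuous_on {u<..<v} (d 1)" using cont by (rule continuous_on_subset) auto
    then have "continuous_on {u<..<v} (\<lambda>t. vector_derivative \<gamma> (at t))"
      by (rule continuous_on_eq) (simp add: v)
    then show "isCont (\<lambda>t. vector_derivative \<gamma> (at t)) t"
      using t by (simp add: continuous_on_eq_continuous_at)
  qed
  ultimately show thesis by (rule that)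
qed

lemma smooth_pieces_regular:
  fixes s :: "nat \<Rightarrow> real"
  assumes "\<And>i. i < N \<Longrightarrow> s i < s (Suc i) \<and> smooth_arc (s i) (s (Suc i)) \<gamma>"
  shows "s 0 \<le> s N \<and> continuous_on {s 0..s N} \<gamma> \<and> (\<exists>M. \<forall>t\<in>{s 0..s N} - s ` {..N}. regular_at \<gamma> M t)"
  using assms
proof (induction N)
  case 0
  then show ?case by auto
next
  case (Suc N)
  have "s 0 \<le> s N \<and> continuous_on {s 0..s N} \<gamma> \<and> (\<exists>M. \<forall>t\<in>{s 0..s N} - s ` {..N}. regular_at \<gamma> M t)"
    by (rule Suc.IH, rule Suc.prems) simp
  then obtain M where IH: "s 0 \<le> s N" "continuous_on {s 0..s N} \<gamma>"
    and M: "\<And>t. t \<in> {s 0..s N} - s ` {..N} \<Longrightarrow> regular_at \<gamma> M t" by blast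
  have lt: "s N < s (Suc N)" and arc: "smooth_arc (s N) (s (Suc N)) \<gamma>" using Suc.prems[of N] by simp_all
  obtain M' where M': "continuous_on {s N..s (Suc N)} \<gamma>" "\<And>t. t \<in> {s N<..<s (Suc N)} \<Longrightarrow> regular_at \<gamma> M' t"
    using smooth_arc_regular[OF arc] by blast
  have un: "{s 0..s (Suc N)} = {s 0..s N} \<union> {s N..s (Suc N)}" using IH(1) lt by auto
  have "continuous_on {s 0..s (Suc N)} \<gamma>"
    unfolding un using IH(2) M'(1) by (intro continuous_on_closed_Un) auto
  moreover have "regular_at \<gamma> (max M M') t" if t: "t \<in> {s 0..s (Suc N)} - s ` {..Suc N}" for t
  proof (cases "t \<le> s N")
    case True
    then have "t \<in> {s 0..s N} - s ` {..N}" using t by auto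
    then show ?thesis by (rule regular_at_mono[OF M]) simp
  next
    case False
    moreover have "t \<noteq> s (Suc N)" using t by blast
    ultimately have "t \<in> {s N<..<s (Suc N)}" using t by auto
    then show ?thesis by (rule regular_at_mono[OF M'(2)]) simp
  qed
  moreover have "s 0 \<le> s (Suc N)" using IH(1) lt by simp
  ultimately show ?case by blast
qed

lemma piecewise_smooth_curve_regular:
  assumes "piecewise_smooth_curve t0 t1 \<gamma>"
  obtains S M where "finite S" "continuous_on {t0..t1} \<gamma>" "\<And>t. t \<in> {t0..t1} - S \<Longrightarrow> regular_at \<gamma> M t"
proof -
  obtain s :: "nat \<Rightarrow> real" and N where s: "s 0 = t0" "s N = t1"
    "\<And>i. i < N \<Longrightarrow> s i < s (Suc i) \<and> smooth_arc (s i) (s (Suc i)) \<gamma>"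
    using assms unfolding piecewise_smooth_curve_def by blast
  from smooth_pieces_regular[where s = s and N = N and \<gamma> = \<gamma>, OF s(3)] obtain M where
    "continuous_on {t0..t1} \<gamma>" "\<forall>t\<in>{t0..t1} - s ` {..N}. regular_at \<gamma> M t"
    unfolding s(1,2) by blast
  then show thesis by (intro that[of "s ` {..N}" M]) auto
qed

text \<open>The inverse k carries the component of y into the component of x, which is bounded, and
  h carries it back with bounded image. Exchanging h and k gives the reverse inclusion.\<close>

lemma inside_linear_image_subset:
  assumes h: "bounded_linear h" and k: "continuous_on UNIV k"
    and kh: "\<And>x. k (h x) = x" and hk: "\<And>y. h (k y) = y"
  shows "h ` inside X \<subseteq> inside (h ` X)"
proof
  fix y assume "y \<in> h ` inside X"
  then obtain x where x: "x \<in> inside X" "y = h x" by blast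
  then have xX: "x \<notin> X" and bd: "bounded (connected_component_set (- X) x)"
    by (auto simp: inside_def)
  have yX: "y \<notin> h ` X" using xX x(2) kh by (metis imageE)
  define C where "C = connected_component_set (- (h ` X)) y"
  have "connected (k ` C)"
    unfolding C_def by (intro connected_continuous_image continuous_on_subset[OF k]) auto
  moreover have "x \<in> k ` C"
    using yX x(2) kh unfolding C_def by (metis (no_types) ComplI connected_component_refl image_eqI mem_Collect_eq)
  moreover have "k ` C \<subseteq> - X"
  proof
    fix z assume "z \<in> k ` C"
    then obtain w where w: "w \<in> C" "z = k w" by blast
    then have "w \<notin> h ` X" using connected_component_subset[of "- (h ` X)" y] unfolding C_def by blast
    then show "z \<in> - X" using w(2) hk[of w] by force
  qed
  ultimately have "k ` C \<subseteq> connected_component_set (- X) x"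
    by (intro connected_component_maximal)
  moreover have "C = h ` k ` C" by (simp add: image_image hk)
  ultimately have "C \<subseteq> h ` connected_component_set (- X) x" by (metis image_mono)
  then have "bounded C" using bounded_linear_image[OF bd h] bounded_subset by blast
  then show "y \<in> inside (h ` X)" using yX by (simp add: inside_def C_def)
qed

lemma inside_to_complex_image: "inside (to_complex ` X) = to_complex ` inside X"
proof
  show "to_complex ` inside X \<subseteq> inside (to_complex ` X)"
    by (rule inside_linear_image_subset[where k = of_complex])
       (auto intro!: bounded_linear_to_complex continuous_intros)
  have "of_complex ` inside (to_complex ` X) \<subseteq> inside (of_complex ` to_complex ` X)"
    by (rule inside_linear_image_subset[where k = to_complex])
       (auto intro!: bounded_linear_of_complex continuous_intros)
  then have "to_complex ` of_complex ` inside (to_complex ` X) \<subseteq> to_complex ` inside X"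
    by (intro image_mono) (simp add: image_image)
  then show "inside (to_complex ` X) \<subseteq> to_complex ` inside X" by (simp add: image_image)
qed

definition hyp_area :: "(real^2) set \<Rightarrow> real" where
  "hyp_area X = (\<integral>x. hyp_density x * indicator (to_complex ` X) x \<partial>lborel)"

lemma poincare_disc_eq: "poincare_disc = ball 0 1"
proof -
  have "norm x < 1 \<longleftrightarrow> (x$1)\<^sup>2 + (x$2)\<^sup>2 < 1" for x :: "real^2"
    by (simp add: norm_vec_def L2_set_def sum_2)
  then show ?thesis unfolding poincare_disc_def by (intro set_eqI) (simp only: mem_Collect_eq mem_ball_0)
qed

lemma poincare_metric_eq: "poincare_metric x y = 2 / (1 - (norm x)\<^sup>2) * norm y"
  by (simp add: poincare_metric_def norm_vec_def L2_set_def sum_2 algebra_simps)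

text \<open>An affine change of parameter from [t0, t1] to [0, 1] brings the curve into the locale.
  The length is delivered as a \<open>has_integral\<close> fact, so that the integral of df can be
  added to it later.\<close>

lemma simple_closed_curve_hyp_loop:
  assumes "simple_closed_piecewise_smooth_in poincare_disc t0 t1 \<gamma>"
  obtains S L where "finite S" "t0 < t1" "continuous_on {t0..t1} \<gamma>"
    "\<And>t. t \<in> {t0<..<t1} - S \<Longrightarrow> (\<gamma> has_vector_derivative vector_derivative \<gamma> (at t)) (at t)"
    "((\<lambda>t. poincare_metric (\<gamma> t) (vector_derivative \<gamma> (at t))) has_integral L) {t0..t1}"
    "hyp_area (inside (\<gamma> ` {t0..t1})) * (4 * pi + hyp_area (inside (\<gamma> ` {t0..t1}))) \<le> L\<^sup>2"
proof -
  have t01: "t0 < t1" and pw: "piecewise_smooth_curve t0 t1 \<gamma>" and simple: "simple_path (subpath t0 t1 \<gamma>)"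
    and loop: "\<gamma> t1 = \<gamma> t0" and img: "\<gamma> ` {t0..t1} \<subseteq> ball 0 1"
    using assms by (auto simp: simple_closed_piecewise_smooth_in_def poincare_disc_eq)
  obtain S0 M where S0: "finite S0" and cont: "continuous_on {t0..t1} \<gamma>"
    and reg: "\<And>t. t \<in> {t0..t1} - S0 \<Longrightarrow> regular_at \<gamma> M t"
    using piecewise_smooth_curve_regular[OF pw] by blast
  define m where "m = t1 - t0"
  have m: "0 < m" and tm: "t1 = t0 + m" using t01 by (simp_all add: m_def)
  define \<phi> where "\<phi> w = m * w + t0" for w
  define \<psi> where "\<psi> t = (t - t0) / m" for t
  have \<phi>\<psi>: "\<phi> (\<psi> t) = t" for t using m by (simp add: \<phi>_def \<psi>_def)
  have \<psi>\<phi>: "\<psi> (\<phi> w) = w" for w using m by (simp add: \<phi>_def \<psi>_def)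
  have \<phi>_in: "\<phi> w \<in> {t0..t1}" if "w \<in> {0..1}" for w
    using that m mult_left_mono[of w 1 m] by (simp add: \<phi>_def tm)
  have \<phi>_in': "\<phi> w \<in> {t0<..<t1}" if "w \<in> {0<..<1}" for w
    using that m mult_strict_left_mono[of w 1 m] by (simp add: \<phi>_def tm)
  have \<psi>_in': "\<psi> t \<in> {0<..<1}" if "t \<in> {t0<..<t1}" for t
    using that m by (simp add: \<psi>_def tm)
  define S where "S = \<psi> ` S0"
  define p where "p w = to_complex (\<gamma> (\<phi> w))" for w
  define v where "v t = vector_derivative \<gamma> (at t)" for t
  \<comment> \<open>Zero at the break points: a continuous function on an open set times its
    indicator is Borel measurable.\<close>
  define D where "D w = indicator ({0<..<1} - S) w *\<^sub>R (m *\<^sub>R to_complex (v (\<phi> w)))" for w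
  have finS: "finite S" using S0 by (simp add: S_def)
  have \<phi>_reg: "regular_at \<gamma> M (\<phi> w)" if "w \<in> {0<..<1} - S" for w
  proof (rule reg)
    have "\<phi> w \<notin> S0" using that \<psi>\<phi>[of w] by (force simp: S_def)
    then show "\<phi> w \<in> {t0..t1} - S0" using \<phi>_in[of w] that by auto
  qed
  have p_eq: "p = to_complex \<circ> subpath t0 t1 \<gamma>"
    by (auto simp: p_def fun_eq_iff subpath_def \<phi>_def m_def)
  have p_image: "path_image p = to_complex ` \<gamma> ` {t0..t1}"
    using t01 by (simp add: p_eq path_image_compose path_image_subpath)
  have "compact (\<gamma> ` {t0..t1})" using cont by (intro compact_continuous_image) auto
  moreover have "\<gamma> ` {t0..t1} \<noteq> {}" using t01 by auto
  ultimately obtain z where z: "z \<in> \<gamma> ` {t0..t1}" "\<And>y. y \<in> \<gamma> ` {t0..t1} \<Longrightarrow> norm y \<le> norm z"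
    using continuous_attains_sup[of "\<gamma> ` {t0..t1}" norm] by (auto intro: continuous_intros)
  have z1: "norm z < 1" using z(1) img by auto
  \<comment> \<open>Halfway between the largest norm on the curve and 1.\<close>
  define R where "R = (1 + norm z) / 2"
  have R: "0 < R" "R < 1" "norm z < R" using z1 by (simp_all add: R_def add_pos_nonneg)
  have cont_v: "continuous_on ({0<..<1} - S) (\<lambda>w. m *\<^sub>R to_complex (v (\<phi> w)))"
  proof -
    have "isCont (\<lambda>w. v (\<phi> w)) w" if "w \<in> {0<..<1} - S" for w
    proof (rule isCont_o2[where f = \<phi> and g = v])
      show "isCont \<phi> w" unfolding \<phi>_def by (intro continuous_intros)
      show "isCont v (\<phi> w)" using \<phi>_reg[OF that] unfolding regular_at_def v_def[abs_def] by blast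
    qed
    then have "continuous_on ({0<..<1} - S) (\<lambda>w. v (\<phi> w))"
      by (simp add: continuous_at_imp_continuous_on)
    then show ?thesis by (intro continuous_to_complex continuous_on_scaleR continuous_on_const)
  qed
  \<comment> \<open>The chain rule contributes m; \<open>max M 0\<close> keeps the bound nonnegative
    where \<open>D\<close> is set to 0.\<close>
  interpret hyp_loop p D S "m * max M 0" R
  proof
    show "simple_path p" unfolding p_eq
      using simple simple_path_linear_image_eq[OF linear_to_complex inj_to_complex] by blast
    show "pathfinish p = pathstart p" using loop by (simp add: pathfinish_def pathstart_def p_def \<phi>_def m_def)
    show "path_image p \<subseteq> ball 0 R" unfolding p_image using z(2) R(3) by (auto dest!: z(2))
    show "0 < R" "R < 1" "finite S" by (rule R finS)+
    show "(p has_vector_derivative D w) (at w)" if w: "w \<in> {0<..<1} - S" for w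
    proof -
      have "(\<phi> has_vector_derivative m) (at w)"
        unfolding \<phi>_def has_real_derivative_iff_has_vector_derivative[symmetric]
        by (auto intro!: derivative_eq_intros)
      moreover have "(\<gamma> has_vector_derivative v (\<phi> w)) (at (\<phi> w))" using \<phi>_reg[OF w] unfolding regular_at_def v_def by blast
      ultimately have "((\<gamma> \<circ> \<phi>) has_vector_derivative m *\<^sub>R v (\<phi> w)) (at w)" by (rule vector_diff_chain_at)
      from bounded_linear.has_vector_derivative[OF bounded_linear_to_complex this]
      have "((\<lambda>w. to_complex (\<gamma> (\<phi> w))) has_vector_derivative to_complex (m *\<^sub>R v (\<phi> w))) (at w)" by (simp add: o_def)
      then show ?thesis using w by (simp add: p_def[abs_def] D_def linear_scale[OF linear_to_complex])
    qed
    have "continuous_on ({0<..<1} - S) D \<longleftrightarrow> continuous_on ({0<..<1} - S) (\<lambda>w. m *\<^sub>R to_complex (v (\<phi> w)))"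
      by (rule continuous_on_cong) (auto simp: D_def)
    then show "continuous_on ({0<..<1} - S) D" using cont_v by blast
    have "closed S" using finS by (rule finite_imp_closed)
    then have "{0<..<1} - S \<in> sets borel" by (intro borel_open open_Diff) auto
    then show "D \<in> borel_measurable borel"
      unfolding D_def[abs_def] using cont_v by (intro borel_measurable_continuous_on_indicator)
    show "cmod (D w) \<le> m * max M 0" for w
    proof (cases "w \<in> {0<..<1} - S")
      case True
      then have "norm (v (\<phi> w)) \<le> max M 0" using \<phi>_reg[OF True] by (simp add: regular_at_def v_def max.coboundedI1)
      then show ?thesis using True m by (simp add: D_def)
    next
      case False
      then show ?thesis using m by (simp add: D_def)
    qed
    show "D w = 0" if "w \<notin> {0..1}" for w using that by (auto simp: D_def)
  qed
  have "I = to_complex ` inside (\<gamma> ` {t0..t1})"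
    by (simp add: I_def p_image inside_to_complex_image)
  then have area: "area = hyp_area (inside (\<gamma> ` {t0..t1}))" by (simp add: area_def hyp_area_def)
  define f where "f w = 2 * cmod (D w) / (1 - (cmod (G w))\<^sup>2)" for w
  have "(f has_integral len) UNIV"
    unfolding len_def f_def[abs_def] by (rule has_integral_integral_lborel[OF len_integrable])
  moreover have "f = (\<lambda>w. if w \<in> cbox 0 1 then f w else 0)"
    by (auto simp: f_def fun_eq_iff D_zero)
  ultimately have "(f has_integral len) (cbox 0 1)"
    using has_integral_restrict_UNIV[of "cbox 0 1" f len] by simp
  \<comment> \<open>The coefficients are those of \<open>\<psi>\<close>. The factor m produced here
    is offset by the factor m in \<open>D\<close>.\<close>
  from has_integral_affinity'[OF this, of "1 / m" "- t0 / m"]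
  have "((\<lambda>t. f ((1 / m) *\<^sub>R t + - t0 / m)) has_integral len /\<^sub>R (1 / m) ^ DIM(real)) (cbox ((0 - - t0 / m) /\<^sub>R (1 / m)) ((1 - - t0 / m) /\<^sub>R (1 / m)))"
    using m by simp
  moreover have "(0 - - t0 / m) /\<^sub>R (1 / m) = t0" "(1 - - t0 / m) /\<^sub>R (1 / m) = t1"
    using m by (simp_all add: tm field_simps)
  moreover have "(1 / m) *\<^sub>R t + - t0 / m = \<psi> t" for t by (simp add: \<psi>_def diff_divide_distrib)
  ultimately have "((\<lambda>t. f (\<psi> t)) has_integral len * m) {t0..t1}" using m by (simp add: mult.commute)
  from has_integral_mult_right[OF this, of "1 / m"]
  have "((\<lambda>t. f (\<psi> t) / m) has_integral len) {t0..t1}" using m by simp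
  then have len: "((\<lambda>t. poincare_metric (\<gamma> t) (vector_derivative \<gamma> (at t))) has_integral len) {t0..t1}"
  proof (rule has_integral_spike_finite[rotated 2])
    show "finite (S0 \<union> {t0, t1})" using S0 by simp
    fix t assume t: "t \<in> {t0..t1} - (S0 \<union> {t0, t1})"
    have "\<psi> t \<in> {0<..<1}" using t by (intro \<psi>_in') auto
    moreover have "\<psi> t \<notin> S"
    proof
      assume "\<psi> t \<in> S"
      then obtain r where "r \<in> S0" "\<psi> t = \<psi> r" by (auto simp: S_def)
      then show False using t \<phi>\<psi> by (metis DiffD2 UnI1)
    qed
    ultimately have "D (\<psi> t) = m *\<^sub>R to_complex (v t)" "G (\<psi> t) = to_complex (\<gamma> t)"
      by (simp_all add: D_def \<phi>\<psi> G_eq p_def)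
    then show "poincare_metric (\<gamma> t) (vector_derivative \<gamma> (at t)) = f (\<psi> t) / m"
      using m by (simp add: f_def poincare_metric_eq v_def)
  qed
  show thesis
  proof (rule that)
    show "finite S0" "t0 < t1" "continuous_on {t0..t1} \<gamma>" by (rule S0 t01 cont)+
    show "(\<gamma> has_vector_derivative vector_derivative \<gamma> (at t)) (at t)" if "t \<in> {t0<..<t1} - S0" for t
      using reg[of t] that by (simp add: regular_at_def)
    show "((\<lambda>t. poincare_metric (\<gamma> t) (vector_derivative \<gamma> (at t))) has_integral len) {t0..t1}" by (rule len)
    show "hyp_area (inside (\<gamma> ` {t0..t1})) * (4 * pi + hyp_area (inside (\<gamma> ` {t0..t1}))) \<le> len\<^sup>2"
      using isoperimetric_inequality by (simp add: area)
  qed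
qed

section \<open>The Randers Poincare disc\<close>

lemma randers_poincare_eq:
  "randers_poincare f x y = 2 / (1 - (norm x)\<^sup>2) * norm y + differential_coeffs f x \<bullet> y"
  by (simp add: randers_poincare_def poincare_metric_eq inner_vec_def)

lemma disc_conformal_pos: "x \<in> poincare_disc \<Longrightarrow> 0 < 2 / (1 - (norm x)\<^sup>2)"
  by (simp add: poincare_disc_eq abs_square_less_1)

text \<open>The tensor is l^2 times the identity, so its inverse divides the Euclidean norm by l.
  Constant norm c thus means |b| = c l, the form required by
  \<open>randers_density_const\<close>.\<close>

lemma covector_norm_poincare:
  assumes "x \<in> poincare_disc"
  shows "covector_norm (poincare_tensor x) b = norm b / (2 / (1 - (norm x)\<^sup>2))"
proof -
  define l where "l = 2 / (1 - (norm x)\<^sup>2)"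
  have l: "0 < l" using disc_conformal_pos[OF assms] by (simp add: l_def)
  have n: "1 - (x$1)\<^sup>2 - (x$2)\<^sup>2 = 1 - (norm x)\<^sup>2" by (simp add: norm_vec_def L2_set_def sum_2)
  have A: "poincare_tensor x = mat (l\<^sup>2)"
  proof -
    have "4 / (1 - (norm x)\<^sup>2)\<^sup>2 = l\<^sup>2" by (simp add: l_def power_divide)
    then show ?thesis unfolding poincare_tensor_def mat_def n by (simp only:)
  qed
  have AB: "poincare_tensor x ** mat (1 / l\<^sup>2) = mat 1" "mat (1 / l\<^sup>2) ** poincare_tensor x = mat 1"
    using l by (simp_all add: A matrix_matrix_mult_def mat_def vec_eq_iff forall_2 sum_2)
  have "matrix_inv (poincare_tensor x) = mat (1 / l\<^sup>2)"
  proof -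
    have "\<exists>B. poincare_tensor x ** B = mat 1 \<and> B ** poincare_tensor x = mat 1" using AB by blast
    from someI_ex[OF this] have "poincare_tensor x ** matrix_inv (poincare_tensor x) = mat 1"
      unfolding matrix_inv_def by blast
    then have "mat (1 / l\<^sup>2) ** (poincare_tensor x ** matrix_inv (poincare_tensor x)) = mat (1 / l\<^sup>2) ** mat 1" by simp
    then show ?thesis unfolding matrix_mul_assoc AB by simp
  qed
  then have "covector_norm (poincare_tensor x) b = sqrt (((b$1)\<^sup>2 + (b$2)\<^sup>2) / l\<^sup>2)"
    by (simp add: covector_norm_def mat_def sum_2 power2_eq_square add_divide_distrib)
  also have "\<dots> = norm b / l" using l by (simp add: real_sqrt_divide norm_vec_def L2_set_def sum_2)
  finally show ?thesis by (simp add: l_def)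
qed

lemma smooth_fun_on_has_derivative:
  assumes "smooth_fun_on U f" "open U" "x \<in> U"
  shows "(f has_derivative (\<lambda>v. differential_coeffs f x \<bullet> v)) (at x)"
proof -
  have "C_k_on (Suc 0) U f" using assms(1) by (simp only: smooth_fun_on_def)
  then have "f differentiable_on U" by simp
  then have "f differentiable (at x)" using assms(2,3) by (simp add: differentiable_on_eq_differentiable_at)
  then have d: "(f has_derivative frechet_derivative f (at x)) (at x)" by (simp add: frechet_derivative_works)
  then have lin: "linear (frechet_derivative f (at x))" by (rule has_derivative_linear)
  have "frechet_derivative f (at x) v = differential_coeffs f x \<bullet> v" for v
  proof -
    have "frechet_derivative f (at x) v = frechet_derivative f (at x) (\<Sum>i\<in>UNIV. v $ i *\<^sub>R axis i 1)"
      by (simp add: basis_expansion flip: scalar_mult_eq_scaleR)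
    also have "\<dots> = (\<Sum>i\<in>UNIV. v $ i * frechet_derivative f (at x) (axis i 1))"
      by (simp add: linear_sum[OF lin] linear_scale[OF lin])
    finally show ?thesis
      by (simp add: differential_coeffs_def partial_deriv_def inner_vec_def mult.commute)
  qed
  then have "frechet_derivative f (at x) = (\<lambda>v. differential_coeffs f x \<bullet> v)" by blast
  with d show ?thesis by simp
qed

lemma simple_closed_curve_isoperimetric:
  assumes f: "smooth_fun_on poincare_disc f"
    and curve: "simple_closed_piecewise_smooth_in poincare_disc t0 t1 \<gamma>"
  obtains S where "finite S" 
    "\<And>t. t \<in> {t0<..<t1} - S \<Longrightarrow> (\<gamma> has_vector_derivative vector_derivative \<gamma> (at t)) (at t)"
    "((\<lambda>t. poincare_metric (\<gamma> t) (vector_derivative \<gamma> (at t))) has_integral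
      finsler_length (randers_poincare f) t0 t1 \<gamma>) {t0..t1}"
    "hyp_area (inside (\<gamma> ` {t0..t1})) * (4 * pi + hyp_area (inside (\<gamma> ` {t0..t1})))
      \<le> (finsler_length (randers_poincare f) t0 t1 \<gamma>)\<^sup>2"
proof -
  obtain S L where S: "finite S" and t01: "t0 < t1" and cont: "continuous_on {t0..t1} \<gamma>"
    and der: "\<And>t. t \<in> {t0<..<t1} - S \<Longrightarrow> (\<gamma> has_vector_derivative vector_derivative \<gamma> (at t)) (at t)"
    and L: "((\<lambda>t. poincare_metric (\<gamma> t) (vector_derivative \<gamma> (at t))) has_integral L) {t0..t1}"
    and iso: "hyp_area (inside (\<gamma> ` {t0..t1})) * (4 * pi + hyp_area (inside (\<gamma> ` {t0..t1}))) \<le> L\<^sup>2"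
    by (rule simple_closed_curve_hyp_loop[OF curve]) (rule that)
  have img: "\<gamma> t \<in> poincare_disc" if "t \<in> {t0..t1}" for t
    using curve that by (auto simp: simple_closed_piecewise_smooth_in_def)
  have loop: "\<gamma> t1 = \<gamma> t0" using curve by (simp add: simple_closed_piecewise_smooth_in_def)
  have df: "(f has_derivative (\<lambda>v. differential_coeffs f x \<bullet> v)) (at x)" if "x \<in> poincare_disc" for x
    using f that by (intro smooth_fun_on_has_derivative) (auto simp: poincare_disc_eq)
  \<comment> \<open>Continuity of \<open>f\<close> along the curve is enough to pass the break
    points; on a closed curve the difference of the end values is 0.\<close>
  have "((\<lambda>t. differential_coeffs f (\<gamma> t) \<bullet> vector_derivative \<gamma> (at t)) has_integral f (\<gamma> t1) - f (\<gamma> t0)) {t0..t1}"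
  proof (rule fundamental_theorem_of_calculus_interior_strong[OF S])
    show "t0 \<le> t1" using t01 by simp
    fix t assume t: "t \<in> {t0<..<t1} - S"
    have "((f \<circ> \<gamma>) has_derivative (\<lambda>v. differential_coeffs f (\<gamma> t) \<bullet> v) \<circ> (\<lambda>h. h *\<^sub>R vector_derivative \<gamma> (at t))) (at t)"
      using der[OF t] img[of t] t unfolding has_vector_derivative_def
      by (intro diff_chain_at df) auto
    then show "((\<lambda>t. f (\<gamma> t)) has_vector_derivative differential_coeffs f (\<gamma> t) \<bullet> vector_derivative \<gamma> (at t)) (at t)"
      by (simp add: has_vector_derivative_def o_def)
  next
    have "continuous_on poincare_disc f"
      by (intro continuous_at_imp_continuous_on ballI has_derivative_continuous[OF df])
    then show "continuous_on {t0..t1} (\<lambda>t. f (\<gamma> t))"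
      by (rule continuous_on_compose2[OF _ cont]) (use img in blast)
  qed
  then have "((\<lambda>t. differential_coeffs f (\<gamma> t) \<bullet> vector_derivative \<gamma> (at t)) has_integral 0) {t0..t1}"
    by (simp add: loop)
  from has_integral_add[OF L this]
  have "((\<lambda>t. randers_poincare f (\<gamma> t) (vector_derivative \<gamma> (at t))) has_integral L) {t0..t1}"
    by (simp add: randers_poincare_eq poincare_metric_eq)
  \<comment> \<open>\<open>finsler_length\<close> uses derivatives within the interval, which are
    one-sided only at the two end points.\<close>
  then have "((\<lambda>t. randers_poincare f (\<gamma> t) (vector_derivative \<gamma> (at t within {t0..t1}))) has_integral L) {t0..t1}"
  proof (rule has_integral_spike_finite[rotated 2])
    show "finite {t0, t1}" by simp
    fix t assume "t \<in> {t0..t1} - {t0, t1}"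
    then have "t \<in> interior {t0..t1}" by auto
    then have "at t within {t0..t1} = at t" by (rule at_within_interior)
    then show "randers_poincare f (\<gamma> t) (vector_derivative \<gamma> (at t within {t0..t1})) = randers_poincare f (\<gamma> t) (vector_derivative \<gamma> (at t))"
      by (simp only:)
  qed
  then have "finsler_length (randers_poincare f) t0 t1 \<gamma> = L"
    unfolding finsler_length_def by (rule integral_unique)
  then show thesis using L iso by (intro that[OF S der]) simp_all
qed

lemma area_wrt_eq_hyp_area:
  assumes \<sigma>: "\<And>x. x \<in> poincare_disc \<Longrightarrow> \<sigma> x = q * (2 / (1 - (norm x)\<^sup>2))\<^sup>2"
    and D: "D \<subseteq> poincare_disc" "open D"
  shows "area_wrt \<sigma> D = q * hyp_area D"
proof -
  have "open (of_complex -` D)" using D(2) by (intro open_vimage continuous_intros)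
  moreover have "of_complex -` D = to_complex ` D"
    by (auto simp: image_iff) (metis of_complex_to_complex to_complex_of_complex)+
  ultimately have [measurable]: "to_complex ` D \<in> sets borel" by simp
  have "area_wrt \<sigma> D = (\<integral>x. q * (hyp_density (to_complex x) * indicator (to_complex ` D) (to_complex x)) \<partial>lborel)"
    unfolding area_wrt_def set_lebesgue_integral_def
  proof (intro Bochner_Integration.integral_cong refl)
    fix x
    show "indicat_real D x *\<^sub>R \<sigma> x = q * (hyp_density (to_complex x) * indicator (to_complex ` D) (to_complex x))"
    proof (cases "x \<in> D")
      case True
      then have "\<sigma> x = q * (2 / (1 - (norm x)\<^sup>2))\<^sup>2" using D \<sigma> by blast
      then show ?thesis using True by (simp add: hyp_density_def power_divide)
    next
      case False
      then have "to_complex x \<notin> to_complex ` D" using inj_to_complex by (auto dest: injD)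
      then show ?thesis using False by simp
    qed
  qed
  also have "\<dots> = q * (\<integral>x. hyp_density (to_complex x) * indicator (to_complex ` D) (to_complex x) \<partial>lborel)"
    by (rule integral_mult_right_zero)
  also have "(\<integral>x. hyp_density (to_complex x) * indicator (to_complex ` D) (to_complex x) \<partial>lborel)
      = (\<integral>x. hyp_density x * indicator (to_complex ` D) x \<partial>distr lborel borel to_complex)"
    by (rule integral_distr[symmetric]) measurable
  also have "\<dots> = hyp_area D" by (simp add: hyp_area_def distr_to_complex)
  finally show ?thesis .
qed

section \<open>The Euclidean circle as extremal curve\<close>

definition circle_curve :: "real \<Rightarrow> real \<Rightarrow> real^2" where
  "circle_curve a t = vector [a * cos t, a * sin t]"

lemma circle_curve_eq: "circle_curve a t = of_complex (of_real a * exp (\<i> * of_real t))"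
  by (simp add: circle_curve_def of_complex_def flip: cis_conv_exp)

lemma norm_circle_curve: "0 < a \<Longrightarrow> norm (circle_curve a t) = a"
  by (simp add: circle_curve_eq norm_mult)

text \<open>Differentiation is a shift of the parameter by a quarter turn, so all higher derivatives
  are shifts of the same curve. This supplies the witness for \<open>smooth_arc\<close>.\<close>

lemma circle_curve_derivative: "(circle_curve a has_vector_derivative circle_curve a (t + pi / 2)) (at t within T)"
proof -
  have "((\<lambda>t. of_real a * exp (\<i> * of_real t)) has_vector_derivative of_real a * (\<i> * exp (\<i> * of_real t))) (at t within T)"
    by (auto intro!: derivative_eq_intros has_vector_derivative_real_field)
  from bounded_linear.has_vector_derivative[OF bounded_linear_of_complex this]
  have "((\<lambda>t. of_complex (of_real a * exp (\<i> * of_real t))) has_vector_derivative of_complex (of_real a * (\<i> * exp (\<i> * of_real t)))) (at t within T)" .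
  moreover have "\<i> * exp (\<i> * of_real t) = exp (\<i> * of_real (t + pi / 2))"
    by (simp only: cis_conv_exp[symmetric] cis_mult[symmetric] cis_pi_half mult.commute)
  ultimately show ?thesis unfolding circle_curve_eq[abs_def] by simp
qed

lemma smooth_arc_circle_curve: "smooth_arc u v (circle_curve a)"
  unfolding smooth_arc_def
proof (intro exI[of _ "\<lambda>k t. circle_curve a (t + real k * (pi / 2))"] conjI ballI allI)
  fix t and k :: nat
  have "((\<lambda>t. t + real k * (pi / 2)) has_vector_derivative 1) (at t within {u..v})"
    by (auto intro!: derivative_eq_intros)
  from vector_diff_chain_within[OF this circle_curve_derivative]
  show "((\<lambda>t. circle_curve a (t + real k * (pi / 2))) has_vector_derivative circle_curve a (t + real (Suc k) * (pi / 2))) (at t within {u..v})"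
    by (simp add: o_def algebra_simps add_divide_distrib)
qed simp

lemma subpath_circle_curve: "subpath 0 (2 * pi) (circle_curve a) = of_complex \<circ> circlepath 0 a"
  by (auto simp: subpath_def circle_curve_eq circlepath fun_eq_iff mult_ac)

lemma circle_curve_image: 
  assumes "0 < a"
  shows "circle_curve a ` {0..2*pi} = sphere 0 a"
proof -
  have "circle_curve a ` {0..2*pi} = path_image (subpath 0 (2*pi) (circle_curve a))"
    by (simp add: path_image_subpath)
  also have "\<dots> = of_complex ` sphere 0 a"
    using assms by (simp add: subpath_circle_curve path_image_compose)
  also have "\<dots> = sphere 0 a"
  proof
    show "sphere 0 a \<subseteq> of_complex ` sphere 0 a"
    proof
      fix y :: "real^2" assume "y \<in> sphere 0 a"
      then show "y \<in> of_complex ` sphere 0 a" by (intro image_eqI[of _ _ "to_complex y"]) auto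
    qed
  qed auto
  finally show ?thesis .
qed

lemma simple_closed_circle_curve:
  assumes "0 < a" "a < 1"
  shows "simple_closed_piecewise_smooth_in poincare_disc 0 (2 * pi) (circle_curve a)"
  unfolding simple_closed_piecewise_smooth_in_def
proof (intro conjI)
  show "piecewise_smooth_curve 0 (2 * pi) (circle_curve a)"
    unfolding piecewise_smooth_curve_def
    by (intro exI[of _ "\<lambda>i. if i = 0 then 0 else 2 * pi"] exI[of _ 1]) (simp add: smooth_arc_circle_curve)
  have "inj of_complex" by (metis injI to_complex_of_complex)
  then show "simple_path (subpath 0 (2 * pi) (circle_curve a))"
    using assms simple_path_linear_image_eq[OF linear_of_complex] by (simp add: subpath_circle_curve simple_path_circlepath)
  show "circle_curve a (2 * pi) = circle_curve a 0" by (simp add: circle_curve_def)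
  show "circle_curve a ` {0..2 * pi} \<subseteq> poincare_disc"
    using assms by (simp add: circle_curve_image poincare_disc_eq subset_eq)
qed simp

lemma hyp_area_inside_circle_curve:
  assumes "0 < a" "a < 1"
  shows "hyp_area (inside (circle_curve a ` {0..2*pi})) = 4 * pi * a\<^sup>2 / (1 - a\<^sup>2)"
proof -
  have "inside (sphere (0::real^2) a) = ball 0 a"
    using inside_frontier_eq_interior[of "cball (0::real^2) a"] assms by (simp add: frontier_cball)
  moreover have "to_complex ` ball 0 a = ball 0 a"
  proof
    show "ball 0 a \<subseteq> to_complex ` ball 0 a"
    proof
      fix y :: complex assume "y \<in> ball 0 a"
      then show "y \<in> to_complex ` ball 0 a" by (intro image_eqI[of _ _ "of_complex y"]) auto
    qed
  qed auto
  ultimately show ?thesis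
    using assms integral_hyp_density_ball(2)[of a] by (simp add: hyp_area_def circle_curve_image)
qed

text \<open>In \<open>simple_closed_curve_isoperimetric\<close> the contribution of df has already
  vanished, so only the constant Poincare speed 2 a / (1 - a^2) is integrated.\<close>

lemma finsler_length_circle_curve:
  assumes f: "smooth_fun_on poincare_disc f" and a: "0 < a" "a < 1"
  shows "finsler_length (randers_poincare f) 0 (2 * pi) (circle_curve a) = 4 * pi * a / (1 - a\<^sup>2)"
proof -
  let ?L = "finsler_length (randers_poincare f) 0 (2 * pi) (circle_curve a)"
  have "((\<lambda>t. poincare_metric (circle_curve a t) (vector_derivative (circle_curve a) (at t))) has_integral ?L) {0..2*pi}"
    by (rule simple_closed_curve_isoperimetric[OF f simple_closed_circle_curve[OF a]])
  moreover have "poincare_metric (circle_curve a t) (vector_derivative (circle_curve a) (at t)) = 2 / (1 - a\<^sup>2) * a" for t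
    unfolding vector_derivative_at[OF circle_curve_derivative] poincare_metric_eq using a by (simp add: norm_circle_curve)
  ultimately have "((\<lambda>t. 2 / (1 - a\<^sup>2) * a) has_integral ?L) {0..2*pi}" by simp
  moreover have "((\<lambda>t. 2 / (1 - a\<^sup>2) * a) has_integral (2 * pi) * (2 / (1 - a\<^sup>2) * a)) {0..2*pi}"
    using has_integral_const_real[of "2 / (1 - a\<^sup>2) * a" 0 "2*pi"] by simp
  ultimately have "?L = (2 * pi) * (2 / (1 - a\<^sup>2) * a)" by (rule has_integral_unique)
  then show ?thesis by simp
qed

lemma inside_curve_in_disc:
  assumes "simple_closed_piecewise_smooth_in poincare_disc t0 t1 \<gamma>"
  shows "inside (\<gamma> ` {t0..t1}) \<subseteq> poincare_disc" "open (inside (\<gamma> ` {t0..t1}))"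
proof -
  have img: "\<gamma> ` {t0..t1} \<subseteq> ball 0 1" and "t0 < t1" "simple_path (subpath t0 t1 \<gamma>)"
    using assms by (auto simp: simple_closed_piecewise_smooth_in_def poincare_disc_eq)
  then have "closed (\<gamma> ` {t0..t1})"
    using closed_path_image[OF simple_path_imp_path, of "subpath t0 t1 \<gamma>"] by (simp add: path_image_subpath)
  then show "open (inside (\<gamma> ` {t0..t1}))" by (rule open_inside)
  show "inside (\<gamma> ` {t0..t1}) \<subseteq> poincare_disc"
    using outside_subset_convex[OF convex_ball img] by (auto simp: poincare_disc_eq inside_outside)
qed

theorem theorem1p1:
  fixes f :: "real^2 \<Rightarrow> real" and c a :: real
  assumes "smooth_fun_on poincare_disc f"
    and "\<forall>x\<in>poincare_disc. covector_norm (poincare_tensor x) (differential_coeffs f x) = c"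
    and "c < 1"
    and "0 < a" and "a < 1"
  shows "\<forall>\<sigma>\<in>{sigma_BH, sigma_HT, sigma_max, sigma_min}.
    isoperimetric_solution poincare_disc (randers_poincare f) (\<sigma> (randers_poincare f))
      0 (2 * pi) (\<lambda>t. vector [a * cos t, a * sin t])"
proof
  fix \<sigma> :: "(real^2 \<Rightarrow> real^2 \<Rightarrow> real) \<Rightarrow> real^2 \<Rightarrow> real"
  assume \<sigma>: "\<sigma> \<in> {sigma_BH, sigma_HT, sigma_max, sigma_min}"
  have b: "norm (differential_coeffs f x) = c * (2 / (1 - (norm x)\<^sup>2))" if "x \<in> poincare_disc" for x
    using assms(2) covector_norm_poincare[OF that, of "differential_coeffs f x"] disc_conformal_pos[OF that] that by (auto simp: divide_eq_eq)
  \<comment> \<open>At the origin the conformal factor is 2, which exhibits c as half a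
    norm.\<close>
  have "norm (differential_coeffs f 0) = c * 2" using b[of 0] by (simp add: poincare_disc_eq)
  then have c: "0 \<le> c" using norm_ge_zero[of "differential_coeffs f 0"] by linarith
  obtain q where q: "0 \<le> q"
    "\<And>(F :: real^2 \<Rightarrow> real^2 \<Rightarrow> real) x l b. (\<And>y. F x y = l * norm y + b \<bullet> y) \<Longrightarrow> 0 < l \<Longrightarrow> norm b = c * l \<Longrightarrow> \<sigma> F x = q * l\<^sup>2"
    by (rule randers_density_const[OF \<sigma> c assms(3)]) (rule that, assumption, meson)
  have \<sigma>_eq: "\<sigma> (randers_poincare f) x = q * (2 / (1 - (norm x)\<^sup>2))\<^sup>2" if "x \<in> poincare_disc" for x
    by (rule q(2)[where F = "randers_poincare f" and x = x, OF randers_poincare_eq disc_conformal_pos[OF that] b[OF that]])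
  have area: "area_wrt (\<sigma> (randers_poincare f)) (inside (\<gamma> ` {t0..t1})) = q * hyp_area (inside (\<gamma> ` {t0..t1}))"
    if "simple_closed_piecewise_smooth_in poincare_disc t0 t1 \<gamma>" for t0 t1 \<gamma>
    using \<sigma>_eq inside_curve_in_disc[OF that] by (rule area_wrt_eq_hyp_area)
  note circle = simple_closed_circle_curve[OF assms(4,5)]
  have a2: "a\<^sup>2 < 1" using assms(4,5) by (simp add: abs_square_less_1)
  have "isoperimetric_solution poincare_disc (randers_poincare f) (\<sigma> (randers_poincare f)) 0 (2 * pi) (circle_curve a)"
    unfolding isoperimetric_solution_def
  proof (intro conjI allI impI)
    fix t0 t1 :: real and \<gamma> :: "real \<Rightarrow> real^2"
    assume curve: "simple_closed_piecewise_smooth_in poincare_disc t0 t1 \<gamma>"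
      and len: "finsler_length (randers_poincare f) t0 t1 \<gamma> = finsler_length (randers_poincare f) 0 (2 * pi) (circle_curve a)"
    define A where "A = hyp_area (inside (\<gamma> ` {t0..t1}))"
    define B where "B = 4 * pi * a\<^sup>2 / (1 - a\<^sup>2)"
    have "A * (4 * pi + A) \<le> (finsler_length (randers_poincare f) t0 t1 \<gamma>)\<^sup>2"
      unfolding A_def by (rule simple_closed_curve_isoperimetric[OF assms(1) curve])
    also have "\<dots> = (4 * pi * a / (1 - a\<^sup>2))\<^sup>2"
      by (simp only: len finsler_length_circle_curve[OF assms(1,4,5)])
    \<comment> \<open>Equality holds for the circle: 4 pi + B = 4 pi / (1 - a^2).\<close>
    also have "\<dots> = B * (4 * pi + B)"
      using a2 by (simp add: B_def field_simps power2_eq_square)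
    finally have le: "A * (4 * pi + A) \<le> B * (4 * pi + B)" .
    have "A \<le> B"
    proof (rule ccontr)
      assume "\<not> A \<le> B"
      moreover have "0 \<le> B" using a2 by (simp add: B_def)
      ultimately have "B * (4 * pi + B) < A * (4 * pi + A)"
        by (intro mult_strict_mono') (auto simp: add_pos_nonneg)
      then show False using le by simp
    qed
    then show "area_wrt (\<sigma> (randers_poincare f)) (inside (\<gamma> ` {t0..t1}))
      \<le> area_wrt (\<sigma> (randers_poincare f)) (inside (circle_curve a ` {0..2 * pi}))"
      unfolding area[OF curve] area[OF circle] hyp_area_inside_circle_curve[OF assms(4,5)]
      using q(1) by (intro mult_left_mono) (auto simp: A_def B_def)
  qed (rule circle)
  then show "isoperimetric_solution poincare_disc (randers_poincare f) (\<sigma> (randers_poincare f))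
      0 (2 * pi) (\<lambda>t. vector [a * cos t, a * sin t])"
    by (simp add: circle_curve_def[abs_def])
qed

end
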